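(* Let $K$ be a commutative $\mathbb Q$-algebra, $n\ge1$, and let $F=X-H$ be a polynomial map over $K$ in $n$ variables having symmetric Jacobian matrix, with $H=(H_1,\ldots,H_n)$ homogeneous of degree $3$ and $(JH)^4=0$. Then $F$ is invertible with $$F^{-1}=X+N^{(1)}+N^{(2)}+N^{(3)}+N^{(4)}+N^{(5)}+N^{(6)}+N^{(7)}.$$ In particular, the degree of $F^{-1}$ is $\le 15$.
   Context: $X=(X_1,\ldots,X_n)$, and $JH=(D_iH_j)$ with $D_i=\partial/\partial X_i$. "Homogeneous of degree $3$" means each $H_i\in K[X_1,\ldots,X_n]$ is homogeneous of degree $3$ (possibly zero). "Invertible" means that $F$ has an inverse under composition which is a polynomial map over $K$. Such an $F=X-H$ always has a unique formal inverse $G$ (a system of power series $G_i=X_i+\text{higher degree terms}$ with $F\circ G=G\circ F=X$), and when $H$ is homogeneous of degree $d=3$ it has the form $G=X+N^{(1)}+N^{(2)}+N^{(3)}+\cdots$ with $N^{(m)}$ (an $n$-tuple) homogeneous of degree $m(d-1)+1=2m+1$; this defines the $N^{(m)}$. *)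

theory Defs
  imports "HOL-Analysis.Finite_Cartesian_Product" "HOL-Library.Poly_Mapping"
begin

section \<open>Commutative algebras over the rationals\<close>

locale rat_comm_algebra = vector_space scale
  for scale :: "rat \<Rightarrow> 'a::comm_ring_1 \<Rightarrow> 'a" +
  assumes scale_mult_left: "scale q (x * y) = scale q x * y"

section \<open>Polynomials and polynomial maps in finitely many variables\<close>

text \<open>
  The variables are indexed by a finite type \<open>'n\<close> (so their number \<open>CARD('n)\<close> is positive).
  An exponent vector has type \<open>'n \<Rightarrow>\<^sub>0 nat\<close>; the ring structure (convolution product) on
  \<open>('n \<Rightarrow>\<^sub>0 nat) \<Rightarrow>\<^sub>0 'a\<close> is the one of \<^theory>\<open>HOL-Library.Poly_Mapping\<close>.
\<close>

type_synonym ('n, 'a) mpoly = "('n \<Rightarrow>\<^sub>0 nat) \<Rightarrow>\<^sub>0 'a"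

definition mdeg :: "('n::finite \<Rightarrow>\<^sub>0 nat) \<Rightarrow> nat" where
  "mdeg k = (\<Sum>i\<in>UNIV. Poly_Mapping.lookup k i)"

definition mp_const :: "'a::zero \<Rightarrow> ('n, 'a) mpoly" where
  "mp_const c = Poly_Mapping.single 0 c"

definition mp_var :: "'n \<Rightarrow> ('n, 'a::comm_ring_1) mpoly" where
  "mp_var i = Poly_Mapping.single (Poly_Mapping.single i 1) 1"

definition mp_homogeneous :: "nat \<Rightarrow> ('n::finite, 'a::zero) mpoly \<Rightarrow> bool" where
  "mp_homogeneous d p \<longleftrightarrow> (\<forall>k\<in>Poly_Mapping.keys p. mdeg k = d)"

text \<open>Total degree, with value 0 at the zero polynomial.\<close>

definition mp_degree :: "('n::finite, 'a::zero) mpoly \<Rightarrow> nat" where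
  "mp_degree p = Max (insert 0 (mdeg ` Poly_Mapping.keys p))"

text \<open>
  The partial derivative. Subtraction of exponent vectors is truncated, but it only truncates
  in terms whose coefficient vanishes.
\<close>

definition mp_deriv :: "'n \<Rightarrow> ('n, 'a::comm_ring_1) mpoly \<Rightarrow> ('n, 'a) mpoly" where
  "mp_deriv i p = (\<Sum>k\<in>Poly_Mapping.keys p.
     Poly_Mapping.single (k - Poly_Mapping.single i 1)
       (of_nat (Poly_Mapping.lookup k i) * Poly_Mapping.lookup p k))"

definition mp_compose ::
    "('n::finite, 'a::comm_ring_1) mpoly \<Rightarrow> (('n, 'a) mpoly)^'n \<Rightarrow> ('n, 'a) mpoly" where
  "mp_compose p G = (\<Sum>k\<in>Poly_Mapping.keys p.
     mp_const (Poly_Mapping.lookup p k) * (\<Prod>i\<in>UNIV. (G $ i) ^ Poly_Mapping.lookup k i))"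

type_synonym ('n, 'a) polymap = "(('n, 'a) mpoly)^'n"

definition polymap_id :: "('n::finite, 'a::comm_ring_1) polymap" where
  "polymap_id = (\<chi> i. mp_var i)"

definition polymap_compose ::
    "('n::finite, 'a::comm_ring_1) polymap \<Rightarrow> ('n, 'a) polymap \<Rightarrow> ('n, 'a) polymap" where
  "polymap_compose F G = (\<chi> i. mp_compose (F $ i) G)"

definition is_polymap_inverse ::
    "('n::finite, 'a::comm_ring_1) polymap \<Rightarrow> ('n, 'a) polymap \<Rightarrow> bool" where
  "is_polymap_inverse F P \<longleftrightarrow>
     polymap_compose F P = polymap_id \<and> polymap_compose P F = polymap_id"

definition polymap_invertible :: "('n::finite, 'a::comm_ring_1) polymap \<Rightarrow> bool" where
  "polymap_invertible F \<longleftrightarrow> (\<exists>P. is_polymap_inverse F P)"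

definition polymap_inv :: "('n::finite, 'a::comm_ring_1) polymap \<Rightarrow> ('n, 'a) polymap" where
  "polymap_inv F = (THE P. is_polymap_inverse F P)"

definition polymap_degree :: "('n::finite, 'a::comm_ring_1) polymap \<Rightarrow> nat" where
  "polymap_degree F = Max (range (\<lambda>i. mp_degree (F $ i)))"

definition jacobian :: "('n::finite, 'a::comm_ring_1) polymap \<Rightarrow> (('n, 'a) mpoly)^'n^'n" where
  "jacobian F = (\<chi> i j. mp_deriv j (F $ i))"

section \<open>Formal power series in finitely many variables\<close>

typedef ('n, 'a) mps = "UNIV :: (('n \<Rightarrow>\<^sub>0 nat) \<Rightarrow> 'a) set"
  morphisms mps_coeff Abs_mps ..

lemma mps_coeff_Abs [simp]: "mps_coeff (Abs_mps f) = f"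
  by (simp add: Abs_mps_inverse)

lemma mps_eqI: "(\<And>k. mps_coeff f k = mps_coeff g k) \<Longrightarrow> f = g"
  by (metis ext mps_coeff_inject)

lemma finite_exponent_below:
  fixes k :: "'n::finite \<Rightarrow>\<^sub>0 nat"
  shows "finite {a. \<forall>i. Poly_Mapping.lookup a i \<le> Poly_Mapping.lookup k i}" (is "finite ?A")
proof (rule finite_imageD)
  have "Poly_Mapping.lookup ` ?A \<subseteq> (PiE UNIV (\<lambda>i. {..Poly_Mapping.lookup k i}))"
    by auto
  then show "finite (Poly_Mapping.lookup ` ?A)"
    by (rule finite_subset) (intro finite_PiE; simp)
  show "inj_on Poly_Mapping.lookup ?A"
    by (rule inj_onI) (simp only: poly_mapping.lookup_inject)
qed

lemma finite_exponent_splits [simp]: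
  "finite {(a, b). a + b = (k :: 'n::finite \<Rightarrow>\<^sub>0 nat)}"
proof (rule finite_subset)
  let ?A = "{a. \<forall>i. Poly_Mapping.lookup a i \<le> Poly_Mapping.lookup k i}"
  show "{(a, b). a + b = k} \<subseteq> ?A \<times> ?A"
    by (auto simp: lookup_add)
  show "finite (?A \<times> ?A)"
    using finite_exponent_below[of k] by simp
qed

lemma finite_mdeg_eq: "finite {k :: 'n::finite \<Rightarrow>\<^sub>0 nat. mdeg k = d}"
proof (rule finite_imageD)
  have "Poly_Mapping.lookup k i \<le> mdeg k" for k :: "'n \<Rightarrow>\<^sub>0 nat" and i
    unfolding mdeg_def by (rule member_le_sum) auto
  then have "Poly_Mapping.lookup ` {k :: 'n \<Rightarrow>\<^sub>0 nat. mdeg k = d} \<subseteq> PiE UNIV (\<lambda>i. {..d})"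
    by auto
  then show "finite (Poly_Mapping.lookup ` {k :: 'n \<Rightarrow>\<^sub>0 nat. mdeg k = d})"
    by (rule finite_subset) (intro finite_PiE; simp)
  show "inj_on Poly_Mapping.lookup {k :: 'n \<Rightarrow>\<^sub>0 nat. mdeg k = d}"
    by (rule inj_onI) (simp only: poly_mapping.lookup_inject)
qed

instantiation mps :: (finite, comm_ring_1) comm_ring_1
begin

definition "0 = Abs_mps (\<lambda>k. 0)"
definition "1 = Abs_mps (\<lambda>k. if k = 0 then 1 else 0)"
definition "f + g = Abs_mps (\<lambda>k. mps_coeff f k + mps_coeff g k)"
definition "- f = Abs_mps (\<lambda>k. - mps_coeff f k)"
definition "f - g = Abs_mps (\<lambda>k. mps_coeff f k - mps_coeff g k)"
definition "f * g = Abs_mps (\<lambda>k. \<Sum>(a, b) | a + b = k. mps_coeff f a * mps_coeff g b)"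

instance
proof
  fix f g h :: "('a, 'b) mps"
  show "f * g = g * f"
  proof (rule mps_eqI)
    fix k
    show "mps_coeff (f * g) k = mps_coeff (g * f) k"
      by (auto simp: times_mps_def add.commute mult.commute
          intro!: sum.reindex_bij_witness[of _ "\<lambda>(a, b). (b, a)" "\<lambda>(a, b). (b, a)"])
  qed
  show "f * g * h = f * (g * h)"
  proof (rule mps_eqI)
    fix k
    let ?S = "\<lambda>k :: 'a \<Rightarrow>\<^sub>0 nat. {(a, b). a + b = k}"
    have "mps_coeff (f * g * h) k =
        (\<Sum>p\<in>?S k. \<Sum>q\<in>?S (fst p). mps_coeff f (fst q) * mps_coeff g (snd q) * mps_coeff h (snd p))"
      by (simp add: times_mps_def split_beta sum_distrib_right)
    also have "\<dots> = (\<Sum>(p, q)\<in>(SIGMA p:?S k. ?S (fst p)).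
        mps_coeff f (fst q) * mps_coeff g (snd q) * mps_coeff h (snd p))"
      by (rule sum.Sigma) auto
    also have "\<dots> = (\<Sum>(p, q)\<in>(SIGMA p:?S k. ?S (snd p)).
        mps_coeff f (fst p) * (mps_coeff g (fst q) * mps_coeff h (snd q)))"
      by (rule sum.reindex_bij_witness[of _
            "\<lambda>((a, s), (b, c)). ((a + b, c), (a, b))" "\<lambda>((s, c), (a, b)). ((a, b + c), (b, c))"])
        (auto simp: add.assoc mult.assoc)
    also have "\<dots> = (\<Sum>p\<in>?S k. \<Sum>q\<in>?S (snd p).
        mps_coeff f (fst p) * (mps_coeff g (fst q) * mps_coeff h (snd q)))"
      by (rule sum.Sigma[symmetric]) auto
    also have "\<dots> = mps_coeff (f * (g * h)) k"
      by (simp add: times_mps_def split_beta sum_distrib_left)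
    finally show "mps_coeff (f * g * h) k = mps_coeff (f * (g * h)) k" .
  qed
  show "1 * f = f"
  proof (rule mps_eqI)
    fix k
    have "mps_coeff (1 * f) k = (\<Sum>(a, b)\<in>{(a, b). a + b = k}. if a = 0 then mps_coeff f b else 0)"
      unfolding times_mps_def one_mps_def mps_coeff_Abs by (rule sum.cong) auto
    also have "\<dots> = (\<Sum>(a, b)\<in>{(0 :: 'a \<Rightarrow>\<^sub>0 nat, k)}. if a = 0 then mps_coeff f b else 0)"
      by (rule sum.mono_neutral_right) (auto split: if_splits)
    finally show "mps_coeff (1 * f) k = mps_coeff f k"
      by simp
  qed
  show "(f + g) * h = f * h + g * h"
    by (rule mps_eqI)
      (simp add: times_mps_def plus_mps_def split_beta ring_distribs sum.distrib)
  show "(0 :: ('a, 'b) mps) \<noteq> 1"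
  proof
    assume "(0 :: ('a, 'b) mps) = 1"
    then have "mps_coeff (0 :: ('a, 'b) mps) 0 = mps_coeff 1 0" by simp
    then show False by (simp add: zero_mps_def one_mps_def)
  qed
qed (rule mps_eqI; simp add: plus_mps_def zero_mps_def uminus_mps_def minus_mps_def ac_simps)+

end

definition mps_of_mpoly :: "('n::finite, 'a::comm_ring_1) mpoly \<Rightarrow> ('n, 'a) mps" where
  "mps_of_mpoly p = Abs_mps (Poly_Mapping.lookup p)"

text \<open>
  The substitution \<open>f(G)\<close>, meant for tuples \<open>G\<close> of series without constant term: then
  \<open>\<Prod>i. (G $ i) ^ m i\<close> has only terms of degree at least \<open>mdeg m\<close>, so the coefficient of
  the \<open>k\<close>-th monomial receives contributions only from the finitely many exponents \<open>m\<close>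
  with \<open>mdeg m \<le> mdeg k\<close>.
\<close>

definition mps_compose ::
    "('n::finite, 'a::comm_ring_1) mps \<Rightarrow> (('n, 'a) mps)^'n \<Rightarrow> ('n, 'a) mps" where
  "mps_compose f G = Abs_mps (\<lambda>k. \<Sum>m | mdeg m \<le> mdeg k.
     mps_coeff f m * mps_coeff (\<Prod>i\<in>UNIV. (G $ i) ^ Poly_Mapping.lookup m i) k)"

type_synonym ('n, 'a) seriesmap = "(('n, 'a) mps)^'n"

definition seriesmap_compose ::
    "('n::finite, 'a::comm_ring_1) seriesmap \<Rightarrow> ('n, 'a) seriesmap \<Rightarrow> ('n, 'a) seriesmap" where
  "seriesmap_compose F G = (\<chi> i. mps_compose (F $ i) G)"

definition seriesmap_of_polymap ::
    "('n::finite, 'a::comm_ring_1) polymap \<Rightarrow> ('n, 'a) seriesmap" where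
  "seriesmap_of_polymap F = (\<chi> i. mps_of_mpoly (F $ i))"

text \<open>
  The first conjunct says \<open>G\<^sub>i = X\<^sub>i + terms of degree at least 2\<close>. The notion is
  meant for polynomial maps \<open>F\<close> without constant term, such as \<open>X - H\<close> with \<open>H\<close>
  homogeneous of degree 3.
\<close>

definition is_formal_inverse ::
    "('n::finite, 'a::comm_ring_1) polymap \<Rightarrow> ('n, 'a) seriesmap \<Rightarrow> bool" where
  "is_formal_inverse F G \<longleftrightarrow>
     (\<forall>i k. mdeg k \<le> 1 \<longrightarrow> mps_coeff (G $ i) k = Poly_Mapping.lookup (mp_var i) k) \<and>
     seriesmap_compose (seriesmap_of_polymap F) G = seriesmap_of_polymap polymap_id \<and>
     seriesmap_compose G (seriesmap_of_polymap F) = seriesmap_of_polymap polymap_id"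

definition formal_inverse :: "('n::finite, 'a::comm_ring_1) polymap \<Rightarrow> ('n, 'a) seriesmap" where
  "formal_inverse F = (THE G. is_formal_inverse F G)"

definition mps_hom_part :: "nat \<Rightarrow> ('n::finite, 'a::comm_ring_1) mps \<Rightarrow> ('n, 'a) mpoly" where
  "mps_hom_part d f = (\<Sum>k | mdeg k = d. Poly_Mapping.single k (mps_coeff f k))"

text \<open>
  For \<open>F = X - H\<close> with \<open>H\<close> homogeneous of degree 3, the formal inverse has the form
  \<open>X + N 1 + N 2 + \<dots>\<close> with \<open>N m\<close> homogeneous of degree \<open>m (3 - 1) + 1 = 2 m + 1\<close>, which
  forces \<open>N m\<close> to be its homogeneous part of that degree.
\<close>

definition inverse_term :: "('n::finite, 'a::comm_ring_1) polymap \<Rightarrow> nat \<Rightarrow> ('n, 'a) polymap" where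
  "inverse_term F m = (\<chi> i. mps_hom_part (2 * m + 1) (formal_inverse F $ i))"

end

theory Submission
  imports Defs "HOL-Computational_Algebra.Polynomial_FPS"
begin

text \<open>
  Write \<open>H = {X,X,X}\<close> with a symmetric trilinear product \<open>{_,_,_}\<close>. Symmetry of the Jacobian says
  that \<open>\<langle>{u,v,w}, z\<rangle>\<close> is symmetric in all four arguments, and \<open>(JH)^4 = 0\<close> says that
  \<open>L = {x,x,_}\<close> satisfies \<open>L^4 = 0\<close> at every point \<open>x\<close>. The formal inverse at time \<open>t\<close> is the
  solution of \<open>x = X + t {x,x,x}\<close>, whose \<open>t\<close>-coefficients are the \<open>N m\<close>.
  Differentiating \<open>L^4 x = 0\<close> in all directions yields relations between
  \<open>a = Lx\<close>, \<open>b = La\<close>, \<open>c = Lb\<close>, \<open>e = {x,a,a}\<close>, \<open>f = {x,a,c}\<close>, \<open>h = {a,a,a}\<close> and their products.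
  Since \<open>dx/dt = (1 - 3tL)\<^sup>-\<^sup>1 a = a + 3tb + 9t^2 c\<close>, these relations show that the successive
  \<open>t\<close>-derivatives of \<open>\<langle>a,a\<rangle>\<close> are constant multiples of
  \<open>\<langle>a,b\<rangle>\<close>, \<open>\<langle>a,e\<rangle>\<close>, \<open>\<langle>a,h\<rangle> + 3t\<langle>b,h\<rangle> + 9t^2\<langle>c,h\<rangle>\<close>,
  \<open>\<langle>b,h\<rangle> + 4t\<langle>c,h\<rangle>\<close>, \<open>\<langle>c,h\<rangle>\<close> and finally \<open>0\<close>.
  As \<open>2 da/dt\<close> is the gradient of \<open>\<langle>a,a\<rangle>\<close> with respect to \<open>X\<close>, the coefficients of \<open>a\<close> vanish from
  \<open>t^7\<close> on, and those of \<open>x = X + ta\<close> from \<open>t^8\<close> on.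
\<close>

section \<open>Symmetric trilinear products and derivations\<close>

definition inner_vec :: "'s::comm_ring_1^'n::finite \<Rightarrow> 's^'n \<Rightarrow> 's" (infix "\<bullet>\<bullet>" 70)
  where "u \<bullet>\<bullet> v = (\<Sum>i\<in>UNIV. u$i * v$i)"

lemma inner_vec_commute: "u \<bullet>\<bullet> v = v \<bullet>\<bullet> u"
  by (simp add: inner_vec_def mult.commute)

lemma inner_vec_simps [simp]:
  "(u + u') \<bullet>\<bullet> v = u \<bullet>\<bullet> v + u' \<bullet>\<bullet> v" "v \<bullet>\<bullet> (u + u') = v \<bullet>\<bullet> u + v \<bullet>\<bullet> u'"
  "(u - u') \<bullet>\<bullet> v = u \<bullet>\<bullet> v - u' \<bullet>\<bullet> v" "v \<bullet>\<bullet> (u - u') = v \<bullet>\<bullet> u - v \<bullet>\<bullet> u'"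
  "(- u) \<bullet>\<bullet> v = - (u \<bullet>\<bullet> v)" "v \<bullet>\<bullet> (- u) = - (v \<bullet>\<bullet> u)"
  "(r *s u) \<bullet>\<bullet> v = r * (u \<bullet>\<bullet> v)" "v \<bullet>\<bullet> (r *s u) = r * (v \<bullet>\<bullet> u)"
  "0 \<bullet>\<bullet> v = 0" "v \<bullet>\<bullet> 0 = 0"
  by (simp_all add: inner_vec_def sum.distrib sum_subtractf sum_negf sum_distrib_left
      algebra_simps)

lemma inner_vec_axis: "axis j 1 \<bullet>\<bullet> v = v$j"
  by (simp add: inner_vec_def axis_def if_distrib[of "\<lambda>t. t * _"] cong: if_cong)

text \<open>No ground ring is fixed, so that one notion covers \<open>fps_deriv\<close>, partial
  derivatives and their combinations. That the coefficients \<open>T\<close> are constants is stated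
  separately where it is used.\<close>

definition derivation :: "('s::comm_ring_1 \<Rightarrow> 's) \<Rightarrow> bool" where
  "derivation \<delta> \<longleftrightarrow> (\<forall>x y. \<delta> (x + y) = \<delta> x + \<delta> y) \<and>
    (\<forall>x y. \<delta> (x * y) = \<delta> x * y + x * \<delta> y)"

lemma
  assumes "derivation \<delta>"
  shows derivation_add: "\<delta> (x + y) = \<delta> x + \<delta> y"
    and derivation_mult: "\<delta> (x * y) = \<delta> x * y + x * \<delta> y"
    and derivation_0: "\<delta> 0 = 0" and derivation_1: "\<delta> 1 = 0"
    and derivation_uminus: "\<delta> (- x) = - \<delta> x"
    and derivation_diff: "\<delta> (x - y) = \<delta> x - \<delta> y"
    and derivation_sum: "\<delta> (sum f B) = (\<Sum>i\<in>B. \<delta> (f i))"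
    and derivation_numeral: "\<delta> (numeral k) = 0"
proof -
  show add: "\<delta> (x + y) = \<delta> x + \<delta> y" for x y using assms by (simp add: derivation_def)
  show mult: "\<delta> (x * y) = \<delta> x * y + x * \<delta> y" for x y using assms by (simp add: derivation_def)
  show 0: "\<delta> 0 = 0" using add[of 0 0] by simp
  show 1: "\<delta> 1 = 0" using mult[of 1 1] by simp
  show um: "\<delta> (- x) = - \<delta> x" for x using add[of x "- x"] 0 by (simp add: eq_neg_iff_add_eq_0 add.commute)
  show "\<delta> (x - y) = \<delta> x - \<delta> y" using add[of x "- y"] um by simp
  show "\<delta> (sum f B) = (\<Sum>i\<in>B. \<delta> (f i))"
    by (induction B rule: infinite_finite_induct) (auto simp: 0 add)
  have of_nat: "\<delta> (of_nat m) = 0" for m by (induction m) (auto simp: 0 1 add)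
  show "\<delta> (numeral k) = 0" using of_nat[of "numeral k"] by simp
qed

definition map_vec :: "('s \<Rightarrow> 't) \<Rightarrow> 's^'n \<Rightarrow> 't^'n" where
  "map_vec f v = (\<chi> i. f (v$i))"

lemma map_vec_component [simp]: "map_vec f v $ i = f (v$i)"
  by (simp add: map_vec_def)

lemma
  assumes "derivation \<delta>"
  shows map_vec_add: "map_vec \<delta> (u + v) = map_vec \<delta> u + map_vec \<delta> v"
    and map_vec_diff: "map_vec \<delta> (u - v) = map_vec \<delta> u - map_vec \<delta> v"
    and map_vec_uminus: "map_vec \<delta> (- v) = - map_vec \<delta> v"
    and map_vec_0: "map_vec \<delta> 0 = (0 :: 's::comm_ring_1^'n::finite)"
    and map_vec_numeral_smult: "map_vec \<delta> (numeral k *s v) = numeral k *s map_vec \<delta> v"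
    and derivation_inner_vec: "\<delta> (u \<bullet>\<bullet> v) = map_vec \<delta> u \<bullet>\<bullet> v + u \<bullet>\<bullet> map_vec \<delta> v"
  using assms
  by (simp_all add: vec_eq_iff derivation_add derivation_diff derivation_uminus derivation_0
      derivation_mult derivation_numeral derivation_sum inner_vec_def sum.distrib)

text \<open>Stands in for division by integers and passes coefficientwise to polynomial and power
  series rings.\<close>

definition torsion_free :: "'s::comm_ring_1 itself \<Rightarrow> bool" where
  "torsion_free _ \<longleftrightarrow> (\<forall>n (s::'s). 0 < n \<longrightarrow> of_nat n * s = 0 \<longrightarrow> s = 0)"

lemma torsion_free_numeralD:
  assumes "torsion_free TYPE('s::comm_ring_1)" "numeral k * (s::'s) = 0"
  shows "s = 0"
  using assms unfolding torsion_free_def by (metis of_nat_numeral zero_less_numeral)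

text \<open>Adjacent transpositions generate all permutations of the four indices, so
  \<open>T\<close> is the coefficient tensor of a quartic form.\<close>

locale symmetric_form =
  fixes T :: "'n::finite \<Rightarrow> 'n \<Rightarrow> 'n \<Rightarrow> 'n \<Rightarrow> 's::comm_ring_1"
  assumes T12: "T i j k l = T j i k l"
    and T23: "T i j k l = T i k j l"
    and T34: "T i j k l = T i j l k"
begin

text \<open>Polarised gradient: four times \<open>tri v v v\<close> is the gradient at
  \<open>v\<close> of the quartic form with coefficients \<open>T\<close>.\<close>

definition tri :: "'s^'n \<Rightarrow> 's^'n \<Rightarrow> 's^'n \<Rightarrow> 's^'n" where
  "tri u v w = (\<chi> i. \<Sum>j\<in>UNIV. \<Sum>k\<in>UNIV. \<Sum>l\<in>UNIV. T i j k l * (u$j * (v$k * w$l)))"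

lemma tri_swap: "tri u v w = tri u w v"
proof -
  have "(\<Sum>k\<in>UNIV. \<Sum>l\<in>UNIV. T i j k l * (u$j * (v$k * w$l)))
      = (\<Sum>k\<in>UNIV. \<Sum>l\<in>UNIV. T i j k l * (u$j * (w$k * v$l)))" for i j
    by (subst sum.swap) (intro sum.cong refl, subst T34, simp add: mult.commute)
  then show ?thesis by (simp add: tri_def)
qed

lemma tri_commute: "tri u v w = tri v u w"
proof -
  have "(\<Sum>j\<in>UNIV. \<Sum>k\<in>UNIV. \<Sum>l\<in>UNIV. T i j k l * (u$j * (v$k * w$l)))
      = (\<Sum>j\<in>UNIV. \<Sum>k\<in>UNIV. \<Sum>l\<in>UNIV. T i j k l * (v$j * (u$k * w$l)))" for i
    by (subst sum.swap) (intro sum.cong refl, subst T23, simp add: mult.left_commute)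
  then show ?thesis by (simp add: tri_def)
qed

lemmas tri_ac = tri_commute tri_swap

text \<open>\<open>T12\<close> exchanges the output index with the first input index. Together with
  \<open>tri_ac\<close> this makes the pairing symmetric in all four arguments.\<close>

lemma tri_inner: "tri u v w \<bullet>\<bullet> z = u \<bullet>\<bullet> tri z v w"
proof -
  have "tri u v w \<bullet>\<bullet> z = (\<Sum>i\<in>UNIV. \<Sum>j\<in>UNIV. \<Sum>k\<in>UNIV. \<Sum>l\<in>UNIV. T i j k l * (u$j * (v$k * w$l)) * z$i)"
    by (simp add: tri_def inner_vec_def sum_distrib_right)
  also have "\<dots> = (\<Sum>j\<in>UNIV. \<Sum>i\<in>UNIV. \<Sum>k\<in>UNIV. \<Sum>l\<in>UNIV. T i j k l * (u$j * (v$k * w$l)) * z$i)"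
    by (rule sum.swap)
  also have "\<dots> = (\<Sum>j\<in>UNIV. \<Sum>i\<in>UNIV. \<Sum>k\<in>UNIV. \<Sum>l\<in>UNIV. u$j * (T j i k l * (z$i * (v$k * w$l))))"
    by (intro sum.cong refl, subst T12, simp add: ac_simps)
  also have "\<dots> = u \<bullet>\<bullet> tri z v w"
    by (simp add: tri_def inner_vec_def sum_distrib_left)
  finally show ?thesis .
qed

lemma tri_inner_last: "tri u v w \<bullet>\<bullet> z = w \<bullet>\<bullet> tri u v z"
  by (metis tri_inner tri_commute tri_swap)

lemma tri_simps1:
  "tri (u + u') v w = tri u v w + tri u' v w"
  "tri (u - u') v w = tri u v w - tri u' v w"
  "tri (- u) v w = - tri u v w"
  "tri (r *s u) v w = r *s tri u v w"
  "tri 0 v w = 0"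
  by (simp_all add: tri_def vec_eq_iff sum.distrib sum_subtractf sum_negf sum_distrib_left
      algebra_simps)

lemma tri_simps [simp]:
  "tri (u + u') v w = tri u v w + tri u' v w" "tri v (u + u') w = tri v u w + tri v u' w"
  "tri v w (u + u') = tri v w u + tri v w u'"
  "tri (u - u') v w = tri u v w - tri u' v w" "tri v (u - u') w = tri v u w - tri v u' w"
  "tri v w (u - u') = tri v w u - tri v w u'"
  "tri (- u) v w = - tri u v w" "tri v (- u) w = - tri v u w" "tri v w (- u) = - tri v w u"
  "tri (r *s u) v w = r *s tri u v w" "tri v (r *s u) w = r *s tri v u w"
  "tri v w (r *s u) = r *s tri v w u"
  "tri 0 v w = 0" "tri v 0 w = 0" "tri v w 0 = 0"
  by (simp_all only: tri_simps1 tri_commute[of v] tri_swap[of _ w])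

lemma map_vec_tri:
  assumes "derivation \<delta>" "\<forall>i j k l. \<delta> (T i j k l) = 0"
  shows "map_vec \<delta> (tri u v w) = tri (map_vec \<delta> u) v w + tri u (map_vec \<delta> v) w + tri u v (map_vec \<delta> w)"
  using assms
  by (simp add: tri_def vec_eq_iff derivation_sum derivation_mult sum.distrib algebra_simps)

end

section \<open>Relations implied by nilpotency\<close>

text \<open>Nilpotency is imposed at a single vector \<open>x\<close>, later a generic point;
  derivations moving \<open>x\<close> take over the role of differentiating in the point.\<close>

locale nilpotent_form = symmetric_form T
  for T :: "'n::finite \<Rightarrow> 'n \<Rightarrow> 'n \<Rightarrow> 'n \<Rightarrow> 's::comm_ring_1" +
  fixes x :: "'s^'n"
  assumes torsion_free: "torsion_free TYPE('s)"
    and nilpotent: "tri x x (tri x x (tri x x (tri x x v))) = 0"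
begin

lemma scalar_cancel: "numeral k * (s::'s) = 0 \<Longrightarrow> s = 0"
  by (rule torsion_free_numeralD[OF torsion_free])

lemma vector_cancel: "numeral k *s (v::'s^'n) = 0 \<Longrightarrow> v = 0"
  by (simp add: vec_eq_iff) (metis scalar_cancel)

lemma vector_eqI: "numeral k *s ((u::'s^'n) - v) = 0 \<Longrightarrow> u = v"
  using vector_cancel[of k "u - v"] by simp

section \<open>The operator \<open>L\<close> and the vectors built from it\<close>

definition L :: "'s^'n \<Rightarrow> 's^'n" where "L v = tri x x v"

lemma L_simps [simp]:
  "L (u + v) = L u + L v" "L (u - v) = L u - L v" "L (- v) = - L v"
  "L (r *s v) = r *s L v" "L 0 = 0" "L (L (L (L v))) = 0"
  by (simp_all add: L_def nilpotent)

lemma L_inner: "L u \<bullet>\<bullet> v = u \<bullet>\<bullet> L v"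
  unfolding L_def by (metis tri_inner tri_commute tri_swap)

definition a :: "'s^'n" where "a = L x"
definition b :: "'s^'n" where "b = L a"
definition c :: "'s^'n" where "c = L b"
definition e :: "'s^'n" where "e = tri x a a"
definition f :: "'s^'n" where "f = tri x a c"
definition h :: "'s^'n" where "h = tri a a a"

lemma Lx: "L x = a" and La: "L a = b" and Lb: "L b = c" and Lc [simp]: "L c = 0"
  by (simp_all add: a_def b_def c_def)

lemma tri_x_x: "tri x x v = L v" "tri x v x = L v" "tri v x x = L v"
  by (metis L_def tri_commute tri_swap)+

text \<open>The operator \<open>L\<close> itself depends quadratically on \<open>x\<close>, whence
  the extra term with factor 2.\<close>

lemma map_vec_L:
  assumes "derivation \<delta>" "\<forall>i j k l. \<delta> (T i j k l) = 0"
  shows "map_vec \<delta> (L v) = 2 *s tri x (map_vec \<delta> x) v + L (map_vec \<delta> v)"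
proof -
  have "map_vec \<delta> (L v) = tri (map_vec \<delta> x) x v + tri x (map_vec \<delta> x) v + L (map_vec \<delta> v)"
    by (simp add: L_def map_vec_tri[OF assms])
  then show ?thesis by (simp add: tri_commute[of "map_vec \<delta> x" x] vec_eq_iff)
qed

text \<open>The Neumann series for the inverse of \<open>1 - r L\<close>, which stops after the
  cubic term because L^4 = 0.\<close>

lemma resolvent:
  assumes "u = v + r *s L u"
  shows "u = v + r *s L v + r^2 *s L (L v) + r^3 *s L (L (L v))"
proof -
  have "L u = L v + r *s L (L u)" by (metis L_simps(1,4) assms)
  moreover from this have "L (L u) = L (L v) + r *s L (L (L u))" by (metis L_simps(1,4))
  moreover from this have "L (L (L u)) = L (L (L v))" by (metis L_simps(1,4,6) add.right_neutral vector_smult_rzero)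
  ultimately show ?thesis
    using assms by (simp add: vec_eq_iff power2_eq_square power3_eq_cube algebra_simps)
qed

end

text \<open>The derivations act as directional derivatives at \<open>x\<close> in an arbitrary
  direction \<open>w\<close>, so every identity between expressions in \<open>x\<close> and
  \<open>T\<close> can be differentiated.\<close>

locale nilpotent_quartic = nilpotent_form T x
  for T :: "'n::finite \<Rightarrow> 'n \<Rightarrow> 'n \<Rightarrow> 'n \<Rightarrow> 's::comm_ring_1" and x +
  assumes exists_derivation:
      "\<exists>\<delta>. derivation \<delta> \<and> (\<forall>i j k l. \<delta> (T i j k l) = 0) \<and> map_vec \<delta> x = w"
begin

text \<open>This is L^4 x = 0 differentiated in direction \<open>w\<close>. The terms in which L^4
  hits \<open>w\<close> drop out, and the common factor 2 is cancelled.\<close>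

lemma transposed_relation: "L (L (tri x a w)) + L (tri x b w) + tri x c w = 0"
proof -
  obtain \<delta> where d: "derivation \<delta>" "\<forall>i j k l. \<delta> (T i j k l) = 0" "map_vec \<delta> x = w"
    using exists_derivation by blast
  have "0 = map_vec \<delta> (L (L (L (L x))))"
    by (simp add: map_vec_0[OF d(1)])
  also have "\<dots> = 2 *s tri x w (L (L (L x)))
      + L (2 *s tri x w (L (L x)) + L (2 *s tri x w (L x) + L (2 *s tri x w x + L w)))"
    by (simp only: map_vec_L[OF d(1,2)] d(3))
  also have "\<dots> = 2 *s (L (L (tri x a w)) + L (tri x b w) + tri x c w)"
    by (simp add: tri_swap[of x w] tri_x_x c_def b_def a_def vec_eq_iff algebra_simps)
  finally show ?thesis using vector_cancel by metis
qed

text \<open>The adjoint of \<open>transposed_relation\<close>: \<open>L\<close> and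
  \<open>tri x v\<close> are self-adjoint, and pairing with the unit vectors detects a zero
  vector.\<close>

lemma relation: "tri x a (L (L u)) + tri x b (L u) + tri x c u = 0"
proof -
  have "(tri x a (L (L u)) + tri x b (L u) + tri x c u) \<bullet>\<bullet> w = 0" for w
  proof -
    have eq: "tri x v u \<bullet>\<bullet> w = u \<bullet>\<bullet> tri x v w" for u v w
      by (metis tri_inner tri_commute tri_swap)
    have "(tri x a (L (L u)) + tri x b (L u) + tri x c u) \<bullet>\<bullet> w
        = u \<bullet>\<bullet> (L (L (tri x a w)) + L (tri x b w) + tri x c w)"
      by (simp add: eq L_inner)
    then show ?thesis by (simp add: transposed_relation)
  qed
  then show ?thesis by (metis inner_vec_axis inner_vec_commute vec_eq_iff zero_index)
qed

text \<open>The first four come from \<open>relation\<close> at \<open>x\<close>, \<open>a\<close>,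
  \<open>b\<close>, \<open>c\<close>, the last two from \<open>transposed_relation\<close> at
  \<open>a\<close>, \<open>b\<close>.\<close>

lemma
  shows xab: "tri x a b = 0" and xbb: "tri x b b = - 2 *s f" and xbc: "tri x b c = 0"
    and xcc: "tri x c c = 0" and LLe: "L (L e) = - f" and Lf: "L f = 0"
proof -
  have "2 *s tri x a b = 0"
    using relation[of x] by (simp add: Lx La tri_x_x tri_ac vec_eq_iff)
  then show xab: "tri x a b = 0" by (rule vector_cancel)
  have "2 *s f + tri x b b = 0"
    using relation[of a] by (simp add: f_def La Lb tri_swap[of x c a] vec_eq_iff algebra_simps)
  then show xbb: "tri x b b = - 2 *s f" by (simp add: add_eq_0_iff vec_eq_iff)
  have "2 *s tri x b c = 0"
    using relation[of b] by (simp add: Lb tri_swap[of x c b] vec_eq_iff)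
  then show xbc: "tri x b c = 0" by (rule vector_cancel)
  show "tri x c c = 0" using relation[of c] by simp
  show "L (L e) = - f"
    using transposed_relation[of a]
    by (simp add: e_def f_def xab tri_swap[of x b a] tri_swap[of x c a] eq_neg_iff_add_eq_0)
  have "2 *s L f = 0"
    using transposed_relation[of b] by (simp add: xab xbb xbc tri_swap[of x c b] vec_eq_iff)
  then show "L f = 0" by (rule vector_cancel)
qed

section \<open>First-order variation of the vectors when a derivation moves \<open>x\<close>\<close>

context
  fixes \<delta> :: "'s \<Rightarrow> 's" and w :: "'s^'n"
  assumes derivation: "derivation \<delta>" and T: "\<forall>i j k l. \<delta> (T i j k l) = 0"
    and x: "map_vec \<delta> x = w"
begin

lemma map_vec_a: "map_vec \<delta> a = 3 *s L w"
  by (simp add: a_def map_vec_L[OF derivation T] x tri_swap[of x w x] tri_x_x vec_eq_iff algebra_simps)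

lemma map_vec_b: "map_vec \<delta> b = 2 *s tri x w a + 3 *s L (L w)"
  by (simp add: b_def map_vec_L[OF derivation T] x map_vec_a)

lemma map_vec_c: "map_vec \<delta> c = 2 *s tri x w b + 2 *s L (tri x w a) + 3 *s L (L (L w))"
  by (simp add: c_def map_vec_L[OF derivation T] x map_vec_b)

lemma map_vec_e: "map_vec \<delta> e = tri w a a + 6 *s tri x a (L w)"
  by (simp add: e_def map_vec_tri[OF derivation T] x map_vec_a tri_swap[of x "L w" a] vec_eq_iff)

lemma map_vec_f: "map_vec \<delta> f = tri w a c + 3 *s tri x c (L w) + tri x a (map_vec \<delta> c)"
  by (simp add: f_def map_vec_tri[OF derivation T] x map_vec_a tri_swap[of x "L w" c])

lemma map_vec_h: "map_vec \<delta> h = 9 *s tri a a (L w)"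
  by (simp add: h_def map_vec_tri[OF derivation T] map_vec_a tri_swap[of a "L w" a]
      tri_commute[of "L w" a] vec_eq_iff)

end

text \<open>Collects the variations for \<open>w = a\<close>, already simplified by the relations
  above, so that these relations can be differentiated again. The next two lemmas do the same for
  \<open>b\<close> and \<open>c\<close>.\<close>

lemma a_direction:
  obtains \<delta> where "derivation \<delta>" "\<forall>i j k l. \<delta> (T i j k l) = 0" "map_vec \<delta> x = a"
    "map_vec \<delta> a = 3 *s b" "map_vec \<delta> b = 2 *s e + 3 *s c" "map_vec \<delta> c = 2 *s L e"
    "map_vec \<delta> e = h" "map_vec \<delta> f = tri a a c + 2 *s tri x a (L e)"
    "map_vec \<delta> h = 9 *s tri a a b"
proof -
  obtain \<delta> where d: "derivation \<delta>" "\<forall>i j k l. \<delta> (T i j k l) = 0" "map_vec \<delta> x = a"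
    using exists_derivation by blast
  have c: "map_vec \<delta> c = 2 *s L e"
    using map_vec_c[OF d] by (simp add: La Lb xab flip: e_def)
  show ?thesis
    by (rule that[OF d _ _ c])
      (simp_all add: map_vec_a[OF d] map_vec_b[OF d] map_vec_e[OF d] map_vec_f[OF d] c
        map_vec_h[OF d] La Lb xab xbc tri_swap[of x c b] flip: e_def h_def)
qed

lemma b_direction:
  obtains \<delta> where "derivation \<delta>" "\<forall>i j k l. \<delta> (T i j k l) = 0" "map_vec \<delta> x = b"
    "map_vec \<delta> a = 3 *s c" "map_vec \<delta> b = 0" "map_vec \<delta> c = - 4 *s f"
    "map_vec \<delta> e = tri a a b + 6 *s f" "map_vec \<delta> h = 9 *s tri a a c"
proof -
  obtain \<delta> where d: "derivation \<delta>" "\<forall>i j k l. \<delta> (T i j k l) = 0" "map_vec \<delta> x = b"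
    using exists_derivation by blast
  show ?thesis
    by (rule that[OF d])
      (simp_all add: map_vec_a[OF d] map_vec_b[OF d] map_vec_e[OF d] map_vec_c[OF d]
        map_vec_h[OF d] Lb xab xbb xbc tri_swap[of x b a] tri_commute[of b a] tri_swap[of a b a]
        vec_eq_iff flip: f_def)
qed

lemma c_direction:
  obtains \<delta> where "derivation \<delta>" "\<forall>i j k l. \<delta> (T i j k l) = 0" "map_vec \<delta> x = c"
    "map_vec \<delta> a = 0" "map_vec \<delta> b = 2 *s f"
proof -
  obtain \<delta> where d: "derivation \<delta>" "\<forall>i j k l. \<delta> (T i j k l) = 0" "map_vec \<delta> x = c"
    using exists_derivation by blast
  show ?thesis
    by (rule that[OF d]) (simp_all add: map_vec_a[OF d] map_vec_b[OF d] tri_swap[of x c a] flip: f_def)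
qed

text \<open>Differentiate \<open>xab\<close> in direction \<open>b\<close>: this direction fixes
  \<open>b\<close>, and the variation of \<open>a\<close> contributes a multiple of
  \<open>tri x b c\<close>, which is 0.\<close>

lemma abb: "tri a b b = 0"
proof -
  obtain \<delta> where d: "derivation \<delta>" "\<forall>i j k l. \<delta> (T i j k l) = 0" "map_vec \<delta> x = b"
    "map_vec \<delta> a = 3 *s c" "map_vec \<delta> b = 0" "map_vec \<delta> c = - 4 *s f"
    "map_vec \<delta> e = tri a a b + 6 *s f" "map_vec \<delta> h = 9 *s tri a a c"
    by (rule b_direction)
  have "tri a b b = map_vec \<delta> (tri x a b)"
    by (simp add: map_vec_tri[OF d(1,2)] d(3-) xbc tri_commute[of a b] tri_swap[of x c b])
  then show ?thesis by (simp add: xab map_vec_0[OF d(1)])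
qed

text \<open>Differentiate \<open>xab\<close> in direction \<open>c\<close>, in which
  \<open>a\<close> does not vary.\<close>

lemma abc: "tri a b c = - 2 *s tri x a f"
proof -
  obtain \<delta> where d: "derivation \<delta>" "\<forall>i j k l. \<delta> (T i j k l) = 0" "map_vec \<delta> x = c"
    "map_vec \<delta> a = 0" "map_vec \<delta> b = 2 *s f"
    by (rule c_direction)
  have "tri a b c + 2 *s tri x a f = map_vec \<delta> (tri x a b)"
    by (simp add: map_vec_tri[OF d(1,2)] d(3-) tri_ac)
  then show ?thesis
    by (simp add: xab map_vec_0[OF d(1)] vector_smult_lneg eq_neg_iff_add_eq_0)
qed

text \<open>Each is an earlier relation differentiated in direction \<open>a\<close>:
  \<open>xab\<close> gives \<open>aab\<close>, \<open>xcc\<close> gives \<open>acc\<close>,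
  \<open>xbb\<close> gives \<open>aac\<close>, \<open>LLe\<close> gives \<open>LLh\<close>, and the
  new \<open>aab\<close> gives \<open>xah\<close>.\<close>

lemma
  shows aab: "tri a a b = 3 *s f - 2 *s tri x a e"
    and acc: "tri a c c = - 4 *s tri x c (L e)"
    and aac: "tri a a c = - 2 *s tri x a (L e) - 2 *s tri x b e"
    and LLh: "L (L h) = 2 *s tri x b e - 2 *s tri x a (L e) - 2 *s L (tri x a e)"
    and xah: "tri x a h = 3 *s tri x a (L e) - 3 *s tri x b e - 2 *s tri a a e"
proof -
  obtain \<delta> where d: "derivation \<delta>" "\<forall>i j k l. \<delta> (T i j k l) = 0" "map_vec \<delta> x = a"
    "map_vec \<delta> a = 3 *s b" "map_vec \<delta> b = 2 *s e + 3 *s c" "map_vec \<delta> c = 2 *s L e"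
    "map_vec \<delta> e = h" "map_vec \<delta> f = tri a a c + 2 *s tri x a (L e)"
    "map_vec \<delta> h = 9 *s tri a a b"
    by (rule a_direction)
  note der = map_vec_tri[OF d(1,2)] map_vec_L[OF d(1,2)] d(3-) map_vec_0[OF d(1)]
    map_vec_add[OF d(1)] map_vec_diff[OF d(1)] map_vec_numeral_smult[OF d(1)] map_vec_uminus[OF d(1)]
  have "tri a a b + 3 *s tri x b b + (2 *s tri x a e + 3 *s f) = map_vec \<delta> (tri x a b)"
    by (simp add: der f_def)
  then show aab: "tri a a b = 3 *s f - 2 *s tri x a e"
    by (simp add: xab xbb der vec_eq_iff algebra_simps)
  have "tri a c c + 4 *s tri x c (L e) = map_vec \<delta> (tri x c c)"
    by (simp add: der tri_swap[of x "L e" c] vec_eq_iff)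
  then show "tri a c c = - 4 *s tri x c (L e)"
    by (simp add: xcc der vector_smult_lneg eq_neg_iff_add_eq_0)
  have "2 *s (tri a a c - (- 2 *s tri x a (L e) - 2 *s tri x b e)) = map_vec \<delta> (2 *s f + tri x b b)"
    by (simp add: der tri_swap[of x c b] tri_swap[of x e b] tri_swap[of x "L e" a] abb xbc
        vec_eq_iff algebra_simps)
  also have "2 *s f + tri x b b = 0"
    by (simp add: xbb vector_smult_lneg)
  finally show aac: "tri a a c = - 2 *s tri x a (L e) - 2 *s tri x b e"
    unfolding map_vec_0[OF d(1)] by (rule vector_eqI)
  \<comment> \<open>Inserting \<open>aac\<close> cancels the \<open>L e\<close> term; the last two
    relations use the variation of \<open>f\<close> in this short form.\<close>
  have f: "map_vec \<delta> f = - 2 *s tri x b e"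
    by (simp add: der aac vec_eq_iff)
  have "2 *s tri x a (L e) + L (2 *s tri x a e + L h) = map_vec \<delta> (L (L e))"
    by (simp add: der)
  then show "L (L h) = 2 *s tri x b e - 2 *s tri x a (L e) - 2 *s L (tri x a e)"
    by (simp add: LLe map_vec_uminus[OF d(1)] f vec_eq_iff algebra_simps)
  have "map_vec \<delta> (tri a a b) = 6 *s tri a b b + 2 *s tri a a e + 3 *s tri a a c"
    by (simp add: der tri_ac) (simp add: vec_eq_iff)
  moreover have "map_vec \<delta> (3 *s f - 2 *s tri x a e)
      = - 6 *s tri x b e - 2 *s (tri a a e + 3 *s tri x b e + tri x a h)"
    by (simp add: der(1,3-5,7,9-) f vector_smult_assoc)
  ultimately have "2 *s (tri x a h - (3 *s tri x a (L e) - 3 *s tri x b e - 2 *s tri a a e)) = 0"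
    unfolding aab by (simp add: abb aac vec_eq_iff algebra_simps)
  then show "tri x a h = 3 *s tri x a (L e) - 3 *s tri x b e - 2 *s tri a a e"
    by (rule vector_eqI)
qed

section \<open>Scalar relations obtained by pairing the vector relations\<close>

lemma inner_ef: "e \<bullet>\<bullet> f = 0"
proof -
  \<comment> \<open>Move both copies of \<open>L\<close> to \<open>b\<close>, where they give L c =
    0. Expanding by \<open>LLh\<close> instead produces -4 from \<open>xbb\<close> and -2 from
    \<open>f\<close>.\<close>
  have "0 = L (L h) \<bullet>\<bullet> b" by (simp add: L_inner Lb)
  also have "\<dots> = - 6 * (e \<bullet>\<bullet> f)"
    unfolding LLh by (simp add: tri_inner_last L_inner Lb xab xbb flip: f_def)
  \<comment> \<open>The explicit numeral is 6.\<close>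
  finally show ?thesis using scalar_cancel[of "num.Bit0 (num.Bit1 num.One)"] by simp
qed

text \<open>By total symmetry the left side is the pairing of \<open>tri a a c\<close> with
  \<open>a\<close>, to which \<open>aac\<close> applies.\<close>

lemma inner_ch: "c \<bullet>\<bullet> h = - 2 * (e \<bullet>\<bullet> L e)"
proof -
  have "c \<bullet>\<bullet> h = tri a a c \<bullet>\<bullet> a" by (simp add: tri_inner_last h_def)
  also have "\<dots> = - 2 * (e \<bullet>\<bullet> L e)"
    unfolding aac by (simp add: tri_inner_last tri_swap[of x b a] xab L_inner flip: e_def)
  finally show ?thesis .
qed

text \<open>Pair \<open>xah\<close> with \<open>a\<close>: the unknown \<langle>e,h\<rangle>
  reappears on the right with coefficient -2, leaving a multiple of 3 to cancel.\<close>

lemma inner_eh: "e \<bullet>\<bullet> h = e \<bullet>\<bullet> L e"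
proof -
  have "h \<bullet>\<bullet> e = tri x a h \<bullet>\<bullet> a" by (simp add: tri_inner_last e_def)
  also have "\<dots> = 3 * (e \<bullet>\<bullet> L e) - 2 * (e \<bullet>\<bullet> h)"
    unfolding xah
    by (simp add: tri_inner_last tri_swap[of x b a] xab L_inner flip: e_def h_def)
  finally have "3 * (e \<bullet>\<bullet> h - e \<bullet>\<bullet> L e) = 0"
    by (simp add: inner_vec_commute[of h] algebra_simps)
  then show ?thesis using scalar_cancel by fastforce
qed

text \<open>Pair \<open>xah\<close> with \<open>b\<close>: the left side vanishes by
  \<open>xab\<close>, and \<open>aab\<close> with \<open>inner_ef\<close> leaves one term on the
  right.\<close>

lemma inner_e_xae: "e \<bullet>\<bullet> tri x a e = 0"
proof -
  have "0 = tri x a h \<bullet>\<bullet> b" by (simp add: tri_inner_last xab)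
  also have "\<dots> = 4 * (e \<bullet>\<bullet> tri x a e)"
    unfolding xah
    by (simp add: tri_inner_last xab xbb aab inner_ef algebra_simps)
  finally show ?thesis using scalar_cancel by fastforce
qed

text \<open>Differentiate \<open>inner_ch\<close> in direction \<open>a\<close>. The two sides
  become 2 and -4 times \<langle>h,Le\<rangle>.\<close>

lemma inner_hLe: "h \<bullet>\<bullet> L e = 0"
proof -
  obtain \<delta> where d: "derivation \<delta>" "\<forall>i j k l. \<delta> (T i j k l) = 0" "map_vec \<delta> x = a"
    "map_vec \<delta> a = 3 *s b" "map_vec \<delta> b = 2 *s e + 3 *s c" "map_vec \<delta> c = 2 *s L e"
    "map_vec \<delta> e = h" "map_vec \<delta> f = tri a a c + 2 *s tri x a (L e)"
    "map_vec \<delta> h = 9 *s tri a a b"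
    by (rule a_direction)
  have "c \<bullet>\<bullet> tri a a b = tri a b c \<bullet>\<bullet> a"
    by (simp add: tri_inner_last tri_swap[of a b a])
  also have "\<dots> = 0"
    by (simp add: abc tri_inner_last inner_vec_commute[of f] inner_ef flip: e_def)
  finally have caab: "c \<bullet>\<bullet> tri a a b = 0" .
  have "2 * (h \<bullet>\<bullet> L e) = \<delta> (c \<bullet>\<bullet> h)"
    by (simp add: derivation_inner_vec[OF d(1)] d(3-) caab inner_vec_commute[of "L e"])
  also have "\<dots> = - 4 * (h \<bullet>\<bullet> L e)"
    unfolding inner_ch
    by (simp add: derivation_mult[OF d(1)] derivation_uminus[OF d(1)] derivation_numeral[OF d(1)]
        derivation_inner_vec[OF d(1)] map_vec_L[OF d(1,2)] d(3-) inner_e_xae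
        inner_vec_commute[of e "L h"] L_inner)
  finally have "6 * (h \<bullet>\<bullet> L e) = 0"
    by (simp add: algebra_simps)
  then show ?thesis by (rule scalar_cancel)
qed

lemma inner_c_aac: "c \<bullet>\<bullet> tri a a c = 0"
proof -
  have "c \<bullet>\<bullet> tri a a c = tri a c c \<bullet>\<bullet> a"
    by (simp add: tri_inner_last tri_swap[of a c a])
  also have "\<dots> = - 4 * (L e \<bullet>\<bullet> f)"
    by (simp add: acc tri_inner_last tri_swap[of x c a] flip: f_def)
  also have "\<dots> = 0"
    by (simp add: L_inner Lf)
  finally show ?thesis .
qed

text \<open>Three relations among \<open>\<langle>f,h\<rangle>\<close>, \<open>y\<close> and \<open>z\<close>, the last one obtained by differentiating
  \<open>\<langle>c,h\<rangle> = -2\<langle>e,Le\<rangle>\<close> in direction \<open>b\<close>, have only the trivial solution.\<close>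

lemma inner_fh: "f \<bullet>\<bullet> h = 0"
proof -
  define y where "y = L e \<bullet>\<bullet> tri x a e"
  define z where "z = e \<bullet>\<bullet> tri x b e"
  \<comment> \<open>First relation: \<open>xah\<close> paired with \<open>c\<close>.\<close>
  have "f \<bullet>\<bullet> h = tri x a h \<bullet>\<bullet> c"
    by (simp only: tri_inner_last inner_vec_commute[of f h] f_def[symmetric])
  also have "\<dots> = - 2 * (e \<bullet>\<bullet> tri a a c)"
    unfolding xah by (simp add: tri_inner_last xbc L_inner Lf flip: f_def)
  also have "e \<bullet>\<bullet> tri a a c = - 2 * y - 2 * z"
    unfolding aac
    by (simp add: y_def z_def inner_vec_commute[of e "tri x a (L e)"] tri_inner_last)
  finally have 1: "f \<bullet>\<bullet> h = 4 * y + 4 * z"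
    by (simp add: algebra_simps)
  \<comment> \<open>Second relation: replace \<open>f\<close> by \<open>- L (L e)\<close>, move
    \<open>L\<close> twice onto \<open>h\<close>, and expand by \<open>LLh\<close>.\<close>
  have "f \<bullet>\<bullet> h = - (L (L h) \<bullet>\<bullet> e)"
    by (simp add: L_inner LLe inner_vec_commute[of f h])
  also have "\<dots> = 4 * y - 2 * z"
    unfolding LLh
    by (simp add: y_def z_def L_inner[of "tri x a e"] inner_vec_commute[of "tri x a e"]
        inner_vec_commute[of "tri x b e"] inner_vec_commute[of "tri x a (L e)"])
      (simp add: inner_vec_commute[of e "tri x a (L e)"] tri_inner_last)
  finally have 2: "f \<bullet>\<bullet> h = 4 * y - 2 * z" .
  have "6 * z = (4 * y + 4 * z) - (4 * y - 2 * z)" by simp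
  then have "6 * z = 0" using 1 2 by simp
  then have z: "z = 0" by (rule scalar_cancel)
  obtain \<delta> where d: "derivation \<delta>" "\<forall>i j k l. \<delta> (T i j k l) = 0" "map_vec \<delta> x = b"
    "map_vec \<delta> a = 3 *s c" "map_vec \<delta> b = 0" "map_vec \<delta> c = - 4 *s f"
    "map_vec \<delta> e = tri a a b + 6 *s f" "map_vec \<delta> h = 9 *s tri a a c"
    by (rule b_direction)
  have "- 4 * (f \<bullet>\<bullet> h) = \<delta> (c \<bullet>\<bullet> h)"
    by (simp add: derivation_inner_vec[OF d(1)] d(3-) inner_c_aac)
  also have "\<dots> = - 2 * \<delta> (e \<bullet>\<bullet> L e)"
    unfolding inner_ch
    by (simp add: derivation_mult[OF d(1)] derivation_uminus[OF d(1)] derivation_numeral[OF d(1)])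
  also have "\<delta> (e \<bullet>\<bullet> L e) = 2 * (map_vec \<delta> e \<bullet>\<bullet> L e) + 2 * z"
    using L_inner[of "map_vec \<delta> e" e]
    by (simp add: derivation_inner_vec[OF d(1)] map_vec_L[OF d(1,2)] d(3) z_def
        inner_vec_commute[of e "L (map_vec \<delta> e)"])
  also have "map_vec \<delta> e \<bullet>\<bullet> L e = - 2 * y"
    unfolding d(7) aab
    by (simp add: y_def inner_vec_commute[of _ "L e"] L_inner[of e f] Lf)
  \<comment> \<open>With \<open>z = 0\<close>, the first relation turns the left side into -16 y,
    against 8 y on the right.\<close>
  finally have "- 4 * (4 * y) = 8 * y" using 1 z by simp
  then have "24 * y = 0" by (simp add: algebra_simps)
  then have "y = 0" by (rule scalar_cancel)
  then show ?thesis using 1 z by simp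
qed

text \<open>Most cases move copies of \<open>L\<close> until L c = 0 applies. For \<open>c\<close>
  and \<open>e\<close>, symmetry gives \<langle>c,e\<rangle> = \<langle>a,f\<rangle>, while c =
  L(La) and \<open>LLe\<close> give the opposite sign.\<close>

lemma inner_low:
  shows "a \<bullet>\<bullet> c = 0" "b \<bullet>\<bullet> b = 0" "b \<bullet>\<bullet> c = 0" "c \<bullet>\<bullet> c = 0"
    "b \<bullet>\<bullet> e = 0" "c \<bullet>\<bullet> e = 0" "a \<bullet>\<bullet> f = 0"
proof -
  show ac: "a \<bullet>\<bullet> c = 0" unfolding a_def L_inner by simp
  show "b \<bullet>\<bullet> b = 0" using ac unfolding b_def L_inner by (simp add: La Lb)
  show "b \<bullet>\<bullet> c = 0" unfolding b_def L_inner by simp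
  show "c \<bullet>\<bullet> c = 0" unfolding c_def L_inner by (simp flip: c_def)
  show "b \<bullet>\<bullet> e = 0"
    unfolding e_def by (simp add: inner_vec_commute[of b] tri_inner_last xab)
  have af: "a \<bullet>\<bullet> f = c \<bullet>\<bullet> e"
    unfolding e_def by (simp add: inner_vec_commute[of c] tri_inner_last f_def)
  have "c \<bullet>\<bullet> e = - (a \<bullet>\<bullet> f)"
    unfolding c_def b_def by (simp add: L_inner LLe)
  then have "2 * (c \<bullet>\<bullet> e) = 0" unfolding af by (metis mult_2 add.right_inverse)
  then show "c \<bullet>\<bullet> e = 0" by (rule scalar_cancel)
  then show "a \<bullet>\<bullet> f = 0" using af by simp
qed

text \<open>Total symmetry moves the arguments until \<open>h\<close>, \<open>abb\<close> or
  \<open>abc\<close> appears; the \<open>abc\<close> cases end in \<langle>e,f\<rangle> = 0.\<close>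

lemma inner_high:
  shows "a \<bullet>\<bullet> tri a a v = v \<bullet>\<bullet> h" "b \<bullet>\<bullet> tri a a b = 0"
    "b \<bullet>\<bullet> tri a a c = 0" "c \<bullet>\<bullet> tri a a b = 0"
proof -
  show "a \<bullet>\<bullet> tri a a v = v \<bullet>\<bullet> h"
    by (metis h_def inner_vec_commute tri_inner_last)
  have "b \<bullet>\<bullet> tri a a b = tri a b b \<bullet>\<bullet> a"
    by (simp add: tri_inner_last tri_swap[of a b a])
  then show "b \<bullet>\<bullet> tri a a b = 0" by (simp add: abb)
  have *: "tri a b c \<bullet>\<bullet> a = 0"
    by (simp add: abc tri_inner_last inner_vec_commute[of f] inner_ef flip: e_def)
  have "b \<bullet>\<bullet> tri a a c = tri a c b \<bullet>\<bullet> a"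
    by (simp add: tri_inner_last tri_swap[of a c a])
  then show "b \<bullet>\<bullet> tri a a c = 0" using * by (simp add: tri_swap[of a c b])
  have "c \<bullet>\<bullet> tri a a b = tri a b c \<bullet>\<bullet> a"
    by (simp add: tri_inner_last tri_swap[of a b a])
  then show "c \<bullet>\<bullet> tri a a b = 0" using * by simp
qed

text \<open>Time enters only through an element \<open>t\<close> with \<open>D t = 1\<close>, and
  the third premise is the velocity of the flow. The second conclusion serves to recognise the
  gradient of \<langle>a,a\<rangle>.\<close>

theorem sixth_derivative_inner_a_a:
  assumes D: "derivation D" "\<forall>i j k l. D (T i j k l) = 0" and t: "D t = 1"
    and x: "map_vec D x = a + (3 * t) *s b + (9 * t^2) *s c"
  shows "(D ^^ 6) (a \<bullet>\<bullet> a) = 0" and "map_vec D a = 3 *s b + (9 * t) *s c"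
proof -
  define w where "w = a + (3 * t) *s b + (9 * t^2) *s c"
  have Lw: "L w = b + (3 * t) *s c" by (simp add: w_def La Lb)
  note w = x[folded w_def]
  show Da: "map_vec D a = 3 *s b + (9 * t) *s c"
    by (simp add: map_vec_a[OF D w] Lw vec_eq_iff algebra_simps)
  have wa: "tri x w a = e + (9 * t^2) *s f" and wb: "tri x w b = - (6 * t) *s f"
    by (simp_all add: w_def tri_swap[of x b a] tri_swap[of x c a] tri_swap[of x c b] xab xbb xbc
        vec_eq_iff flip: e_def f_def)
  have Db: "map_vec D b = 2 *s e + (18 * t^2) *s f + 3 *s c"
    by (simp add: map_vec_b[OF D w] Lw Lb wa vec_eq_iff)
  have Dc: "map_vec D c = - (12 * t) *s f + 2 *s L e"
    by (simp add: map_vec_c[OF D w] Lw Lb wa wb Lf vec_eq_iff)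
  have De: "map_vec D e = h + (3 * t) *s tri a a b + (9 * t^2) *s tri a a c + (18 * t) *s f"
    by (simp add: map_vec_e[OF D w] La Lb xab w_def tri_commute[of b a a] tri_swap[of a b a]
        tri_commute[of c a a] tri_swap[of a c a] vec_eq_iff flip: f_def h_def)
  have Dh: "map_vec D h = 9 *s tri a a b + (27 * t) *s tri a a c"
    by (simp add: map_vec_h[OF D w] Lw vec_eq_iff)
  note Ds = derivation_mult[OF D(1)] derivation_add[OF D(1)] derivation_uminus[OF D(1)]
    derivation_numeral[OF D(1)] derivation_0[OF D(1)] t
  note Di = derivation_inner_vec[OF D(1)]
  note comm = inner_vec_commute[of b a] inner_vec_commute[of c a] inner_vec_commute[of c b]
  have 0: "D (a \<bullet>\<bullet> a) = 6 * (a \<bullet>\<bullet> b)"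
    by (simp add: Di Da comm inner_low)
  have 1: "D (a \<bullet>\<bullet> b) = 2 * (a \<bullet>\<bullet> e)"
    by (simp add: Di Da Db comm inner_low)
  have 2: "D (a \<bullet>\<bullet> e) = a \<bullet>\<bullet> h + 3 * t * (b \<bullet>\<bullet> h) + 9 * t^2 * (c \<bullet>\<bullet> h)"
    by (simp add: Di Da De inner_low inner_high)
  have 3: "D (a \<bullet>\<bullet> h) = 12 * (b \<bullet>\<bullet> h) + 36 * t * (c \<bullet>\<bullet> h)"
    by (simp add: Di Da Dh inner_high)
  \<comment> \<open>The variation of \<open>b\<close> contributes 3\<langle>c,h\<rangle> +
    2\<langle>e,h\<rangle>, and 2\<langle>e,h\<rangle> = -\<langle>c,h\<rangle>.\<close>
  have 4: "D (b \<bullet>\<bullet> h) = 2 * (c \<bullet>\<bullet> h)"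
    by (simp add: Di Db Dh inner_high inner_fh inner_eh inner_ch)
  have 5: "D (c \<bullet>\<bullet> h) = 0"
    by (simp add: Di Dc Dh inner_high inner_fh inner_c_aac inner_vec_commute[of "L e"] inner_hLe)
  have 6: "D (D (D (a \<bullet>\<bullet> a))) = 12 * (a \<bullet>\<bullet> h + 3 * t * (b \<bullet>\<bullet> h) + 9 * t^2 * (c \<bullet>\<bullet> h))"
    by (simp add: 0 1 2 Ds)
  \<comment> \<open>Product rule: 15 = 12 + 3 and 60 = 36 + 6 + 18.\<close>
  have 7: "D (a \<bullet>\<bullet> h + 3 * t * (b \<bullet>\<bullet> h) + 9 * t^2 * (c \<bullet>\<bullet> h)) = 15 * (b \<bullet>\<bullet> h) + 60 * t * (c \<bullet>\<bullet> h)"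
    by (simp add: 3 4 5 Ds power2_eq_square algebra_simps)
  have 8: "D (15 * (b \<bullet>\<bullet> h) + 60 * t * (c \<bullet>\<bullet> h)) = 90 * (c \<bullet>\<bullet> h)"
    by (simp add: 4 5 Ds algebra_simps)
  have n: "D (numeral k * s) = numeral k * D s" for k s by (simp add: Ds)
  have "D (D (D (D (D (D (a \<bullet>\<bullet> a)))))) = 0"
    by (simp only: 6 7 8 n 5 mult_zero_right)
  then show "(D ^^ 6) (a \<bullet>\<bullet> a) = 0"
    by (simp add: eval_nat_numeral)
qed

end

section \<open>Evaluation and differentiation of polynomials\<close>

lemma poly_mapping_eq_sum_single:
  "(\<Sum>k\<in>Poly_Mapping.keys p. Poly_Mapping.single k (Poly_Mapping.lookup p k)) = p"
  by (rule poly_mapping_eqI)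
    (simp add: lookup_sum lookup_single when_def in_keys_iff)

lemma mpoly_induct [case_names single add]:
  fixes p :: "'b \<Rightarrow>\<^sub>0 'c::comm_monoid_add"
  assumes single: "\<And>k c. P (Poly_Mapping.single k c)" and add: "\<And>p q. P p \<Longrightarrow> P q \<Longrightarrow> P (p + q)"
  shows "P p"
proof -
  have "P (\<Sum>k\<in>A. Poly_Mapping.single k (Poly_Mapping.lookup p k))" for A
  proof (induction A rule: infinite_finite_induct)
    case (insert k A)
    then show ?case by (simp add: single add)
  \<comment> \<open>Zero counts as a monomial with coefficient 0, whatever its exponent.\<close>
  qed (use single[of undefined 0] in simp_all)
  then show ?thesis by (metis poly_mapping_eq_sum_single)
qed

definition ring_hom_on :: "('a::comm_ring_1 \<Rightarrow> 's::comm_ring_1) \<Rightarrow> bool" where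
  "ring_hom_on \<phi> \<longleftrightarrow> \<phi> 1 = 1 \<and>
    (\<forall>x y. \<phi> (x + y) = \<phi> x + \<phi> y) \<and> (\<forall>x y. \<phi> (x * y) = \<phi> x * \<phi> y)"

lemma
  assumes "ring_hom_on \<phi>"
  shows ring_hom_on_1: "\<phi> 1 = 1" and ring_hom_on_add: "\<phi> (x + y) = \<phi> x + \<phi> y"
    and ring_hom_on_mult: "\<phi> (x * y) = \<phi> x * \<phi> y" and ring_hom_on_0: "\<phi> 0 = 0"
    and ring_hom_on_diff: "\<phi> (x - y) = \<phi> x - \<phi> y"
    and ring_hom_on_sum: "\<phi> (sum f B) = (\<Sum>i\<in>B. \<phi> (f i))"
    and ring_hom_on_prod: "\<phi> (prod f B) = (\<Prod>i\<in>B. \<phi> (f i))"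
    and ring_hom_on_power: "\<phi> (x ^ m) = \<phi> x ^ m"
proof -
  show 1: "\<phi> 1 = 1" and add: "\<phi> (x + y) = \<phi> x + \<phi> y" and mult: "\<phi> (x * y) = \<phi> x * \<phi> y" for x y
    using assms by (auto simp: ring_hom_on_def)
  show 0: "\<phi> 0 = 0" using add[of 0 0] by simp
  show "\<phi> (x - y) = \<phi> x - \<phi> y" using add[of "x - y" y] by simp
  show "\<phi> (sum f B) = (\<Sum>i\<in>B. \<phi> (f i))"
    by (induction B rule: infinite_finite_induct) (auto simp: 0 add)
  show "\<phi> (prod f B) = (\<Prod>i\<in>B. \<phi> (f i))"
    by (induction B rule: infinite_finite_induct) (auto simp: 1 mult)
  show "\<phi> (x ^ m) = \<phi> x ^ m"
    by (induction m) (auto simp: 1 mult)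
qed

text \<open>A variable coefficient map \<open>\<phi>\<close> lets one evaluation theory cover
  composition (\<open>mp_const\<close>), constant terms (\<open>id\<close>), and substitution of
  power series in time or in the variables.\<close>

definition mp_eval :: "('a \<Rightarrow> 's) \<Rightarrow> 's^'n \<Rightarrow> ('n::finite, 'a::comm_ring_1) mpoly \<Rightarrow> 's::comm_ring_1"
  where "mp_eval \<phi> v p = (\<Sum>k\<in>Poly_Mapping.keys p.
    \<phi> (Poly_Mapping.lookup p k) * (\<Prod>i\<in>UNIV. (v $ i) ^ Poly_Mapping.lookup k i))"

lemma mp_compose_eq_mp_eval: "mp_compose p G = mp_eval mp_const G p"
  by (simp add: mp_compose_def mp_eval_def)

context
  fixes \<phi> :: "'a::comm_ring_1 \<Rightarrow> 's::comm_ring_1"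
  assumes \<phi>: "ring_hom_on \<phi>"
begin

lemma mp_eval_superset:
  assumes "finite A" "Poly_Mapping.keys p \<subseteq> A"
  shows "mp_eval \<phi> v p = (\<Sum>k\<in>A. \<phi> (Poly_Mapping.lookup p k) * (\<Prod>i\<in>UNIV. (v $ i) ^ Poly_Mapping.lookup k i))"
  unfolding mp_eval_def using assms
  by (intro sum.mono_neutral_left) (auto simp: in_keys_iff ring_hom_on_0[OF \<phi>])

lemma mp_eval_single:
  "mp_eval \<phi> v (Poly_Mapping.single k c) = \<phi> c * (\<Prod>i\<in>UNIV. (v $ i) ^ Poly_Mapping.lookup k i)"
  by (simp add: mp_eval_superset[of "{k}"])

lemma mp_eval_add: "mp_eval \<phi> v (p + q) = mp_eval \<phi> v p + mp_eval \<phi> v q"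
proof -
  let ?A = "Poly_Mapping.keys p \<union> Poly_Mapping.keys q"
  show ?thesis
    using Poly_Mapping.keys_add[of p q]
    by (simp add: mp_eval_superset[of ?A] lookup_add ring_hom_on_add[OF \<phi>] ring_distribs sum.distrib)
qed

lemma mp_eval_mult: "mp_eval \<phi> v (p * q) = mp_eval \<phi> v p * mp_eval \<phi> v q"
proof (induction p rule: mpoly_induct)
  case (single k c)
  show ?case
    by (induction q rule: mpoly_induct)
      (auto simp: mult_single mp_eval_single ring_hom_on_mult[OF \<phi>] lookup_add power_add
        prod.distrib ring_distribs mp_eval_add)
qed (simp add: ring_distribs mp_eval_add)

lemma ring_hom_on_mp_eval: "ring_hom_on (mp_eval \<phi> v)"
proof -
  have "mp_eval \<phi> v 1 = 1"
    using mp_eval_single[of v 0 1] by (simp add: ring_hom_on_1[OF \<phi>])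
  then show ?thesis by (simp add: ring_hom_on_def mp_eval_add mp_eval_mult)
qed

lemma mp_eval_const: "mp_eval \<phi> v (mp_const c) = \<phi> c"
  by (simp add: mp_const_def mp_eval_single)

lemma mp_eval_var: "mp_eval \<phi> v (mp_var i) = v $ i"
proof -
  have "(\<Prod>j\<in>UNIV. (v $ j) ^ Poly_Mapping.lookup (Poly_Mapping.single i 1) j)
      = (\<Prod>j\<in>UNIV. if j = i then v $ j else 1)"
    by (intro prod.cong refl) (simp add: lookup_single when_def)
  then show ?thesis
    by (simp add: mp_var_def mp_eval_single ring_hom_on_1[OF \<phi>])
qed

end

lemma ring_hom_on_mp_const: "ring_hom_on (mp_const :: 'a::comm_ring_1 \<Rightarrow> ('n, 'a) mpoly)"
  by (simp add: ring_hom_on_def mp_const_def single_add mult_single)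

lemma prod_mp_var_power:
  "(\<Prod>i\<in>UNIV. mp_var i ^ Poly_Mapping.lookup k i) = (Poly_Mapping.single k 1 :: ('n::finite, 'a::comm_ring_1) mpoly)"
proof -
  have power: "mp_var i ^ m = (Poly_Mapping.single (Poly_Mapping.single i m) 1 :: ('n, 'a) mpoly)"
    for i :: 'n and m
    by (induction m) (simp_all add: mp_var_def mult_single flip: single_add single_one)
  have "(\<Prod>i\<in>A. mp_var i ^ Poly_Mapping.lookup k i)
      = (Poly_Mapping.single (\<Sum>i\<in>A. Poly_Mapping.single i (Poly_Mapping.lookup k i)) 1 :: ('n, 'a) mpoly)"
    for A :: "'n set"
    by (induction A rule: infinite_finite_induct) (simp_all add: power mult_single)
  moreover have "(\<Sum>i\<in>UNIV. Poly_Mapping.single i (Poly_Mapping.lookup k i)) = k"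
    by (rule poly_mapping_eqI) (simp add: lookup_sum lookup_single when_def)
  ultimately show ?thesis by simp
qed

lemma mp_eval_id: "mp_eval mp_const polymap_id p = p"
  by (induction p rule: mpoly_induct)
   (simp_all add: mp_eval_single[OF ring_hom_on_mp_const] mp_eval_add[OF ring_hom_on_mp_const]
      polymap_id_def prod_mp_var_power, simp add: mp_const_def mult_single)

lemma mp_eval_mp_eval:
  assumes "ring_hom_on \<phi>"
  shows "mp_eval \<phi> v (mp_eval mp_const G p) = mp_eval \<phi> (map_vec (mp_eval \<phi> v) G) p"
proof -
  note hom = ring_hom_on_mp_eval[OF assms, of v]
  show ?thesis
    unfolding mp_eval_def[of mp_const] mp_eval_def[of \<phi> "map_vec _ _"]
    by (simp add: ring_hom_on_sum[OF hom] ring_hom_on_mult[OF hom] ring_hom_on_prod[OF hom]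
        ring_hom_on_power[OF hom] mp_eval_const[OF assms])
qed

lemma polymap_compose_assoc:
  "polymap_compose (polymap_compose F G) P = polymap_compose F (polymap_compose G P)"
  by (simp add: polymap_compose_def vec_eq_iff mp_compose_eq_mp_eval
      mp_eval_mp_eval[OF ring_hom_on_mp_const] map_vec_def)

lemma polymap_compose_id: "polymap_compose F polymap_id = F" "polymap_compose polymap_id F = F"
  by (simp_all add: polymap_compose_def vec_eq_iff mp_compose_eq_mp_eval mp_eval_id)
    (simp add: polymap_id_def mp_eval_var[OF ring_hom_on_mp_const])

text \<open>Polynomial maps form a monoid under composition, and two-sided inverses in a monoid are
  unique.\<close>

lemma polymap_inv_eqI:
  assumes "is_polymap_inverse F P"
  shows "polymap_inv F = P"
  unfolding polymap_inv_def
proof (rule the_equality)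
  fix Q assume "is_polymap_inverse F Q"
  then show "Q = P"
    using assms unfolding is_polymap_inverse_def
    by (metis polymap_compose_assoc polymap_compose_id)
qed fact

section \<open>Degrees, partial derivatives and Euler's identity\<close>

lemma mdeg_add: "mdeg (k + l) = mdeg k + mdeg l"
  by (simp add: mdeg_def lookup_add sum.distrib)

lemma mdeg_0_iff: "mdeg k = 0 \<longleftrightarrow> k = 0"
  by (auto simp: mdeg_def poly_mapping_eq_iff fun_eq_iff)

lemma mdeg_single: "mdeg (Poly_Mapping.single i m) = m"
  by (simp add: mdeg_def lookup_single when_def)

lemma diff_single_add:
  assumes "Poly_Mapping.lookup k i \<noteq> 0"
  shows "k - Poly_Mapping.single i (1::nat) + Poly_Mapping.single i 1 = k"
  using assms by (intro poly_mapping_eqI) (auto simp: lookup_add lookup_minus lookup_single when_def)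

lemma mp_deriv_superset:
  assumes "finite A" "Poly_Mapping.keys p \<subseteq> A"
  shows "mp_deriv i p = (\<Sum>k\<in>A. Poly_Mapping.single (k - Poly_Mapping.single i 1)
       (of_nat (Poly_Mapping.lookup k i) * Poly_Mapping.lookup p k))"
  unfolding mp_deriv_def using assms
  by (intro sum.mono_neutral_left) (auto simp: in_keys_iff)

lemma mp_deriv_single:
  "mp_deriv i (Poly_Mapping.single k c)
    = Poly_Mapping.single (k - Poly_Mapping.single i 1) (of_nat (Poly_Mapping.lookup k i) * c)"
  by (subst mp_deriv_superset[of "{k}"]) auto

lemma mp_deriv_add: "mp_deriv i (p + q) = mp_deriv i p + mp_deriv i q"
proof -
  let ?A = "Poly_Mapping.keys p \<union> Poly_Mapping.keys q"
  show ?thesis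
    using Poly_Mapping.keys_add[of p q]
    by (simp add: mp_deriv_superset[of ?A] lookup_add ring_distribs sum.distrib single_add)
qed

text \<open>If the exponent of the variable is 0, the subtraction may truncate, but then both
  coefficients are 0.\<close>

lemma single_diff_add_coeff:
  fixes c :: "'a::comm_ring_1"
  shows "Poly_Mapping.single (k - Poly_Mapping.single i 1 + l) (of_nat (Poly_Mapping.lookup k i) * c)
    = Poly_Mapping.single (k + l - Poly_Mapping.single i 1) (of_nat (Poly_Mapping.lookup k i) * c)"
proof (cases "Poly_Mapping.lookup k i = 0")
  case False
  have "k - Poly_Mapping.single i 1 + l = k + l - Poly_Mapping.single i 1"
    using False
    by (intro poly_mapping_eqI) (auto simp: lookup_add lookup_minus lookup_single when_def)
  then show ?thesis by simp
qed simp

lemma mp_deriv_mult_single: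
  fixes c d :: "'a::comm_ring_1"
  shows "mp_deriv i (Poly_Mapping.single k c * Poly_Mapping.single l d)
    = mp_deriv i (Poly_Mapping.single k c) * Poly_Mapping.single l d
      + Poly_Mapping.single k c * mp_deriv i (Poly_Mapping.single l d)"
  using single_diff_add_coeff[of k i l "c * d"] single_diff_add_coeff[of l i k "c * d"]
  by (simp add: mult_single mp_deriv_single lookup_add ring_distribs single_add ac_simps)

lemma derivation_mp_deriv: "derivation (mp_deriv i :: ('n, 'a::comm_ring_1) mpoly \<Rightarrow> _)"
proof -
  have "mp_deriv i (p * q) = mp_deriv i p * q + p * mp_deriv i q" for p q :: "('n, 'a) mpoly"
  proof (induction p rule: mpoly_induct)
    case (single k c)
    show ?case
      by (induction q rule: mpoly_induct)
        (auto simp only: mp_deriv_mult_single ring_distribs mp_deriv_add add.assoc add.left_commute)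
  qed (simp add: mp_deriv_add algebra_simps)
  then show ?thesis by (simp add: derivation_def mp_deriv_add)
qed

lemma mp_deriv_const: "mp_deriv i (mp_const c) = 0"
  by (simp add: mp_const_def mp_deriv_single)

lemma mp_deriv_var: "mp_deriv j (mp_var i) = (if i = j then 1 else 0)"
  by (simp add: mp_var_def mp_deriv_single lookup_single when_def)

lemma mp_deriv_commute: "mp_deriv i (mp_deriv j p) = mp_deriv j (mp_deriv i p)"
proof (induction p rule: mpoly_induct)
  case (single k c)
  have "k - Poly_Mapping.single j 1 - Poly_Mapping.single i 1
      = k - Poly_Mapping.single i 1 - Poly_Mapping.single j (1::nat)"
    by (intro poly_mapping_eqI) (simp add: lookup_minus)
  then show ?case
    by (cases "i = j") (auto simp: mp_deriv_single lookup_minus lookup_single ac_simps)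
qed (simp add: mp_deriv_add)

lemma mp_var_mult_mp_deriv_single:
  "mp_var i * mp_deriv i (Poly_Mapping.single k c)
    = Poly_Mapping.single k (of_nat (Poly_Mapping.lookup k i) * c)"
  by (cases "Poly_Mapping.lookup k i = 0")
    (simp_all add: mp_var_def mp_deriv_single mult_single add.commute[of "Poly_Mapping.single i 1"]
      diff_single_add flip: One_nat_def)

lemma euler_single:
  "(\<Sum>i\<in>UNIV. mp_var i * mp_deriv i (Poly_Mapping.single k c)) = of_nat (mdeg k) * Poly_Mapping.single k c"
proof -
  have "of_nat m * Poly_Mapping.single k c = Poly_Mapping.single k (of_nat m * c)" for m
    by (induction m) (simp_all add: ring_distribs single_add)
  then have "Poly_Mapping.single k (of_nat m * c) = of_nat m * Poly_Mapping.single k c" for m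
    by simp
  then show ?thesis
    by (simp only: mp_var_mult_mp_deriv_single mdeg_def of_nat_sum sum_distrib_right)
qed

lemma euler:
  assumes "mp_homogeneous d p"
  shows "(\<Sum>i\<in>UNIV. mp_var i * mp_deriv i p) = of_nat d * p"
proof -
  let ?s = "\<lambda>k. Poly_Mapping.single k (Poly_Mapping.lookup p k)"
  have "(\<Sum>i\<in>UNIV. mp_var i * mp_deriv i (\<Sum>k\<in>Poly_Mapping.keys p. ?s k))
      = (\<Sum>k\<in>Poly_Mapping.keys p. of_nat (mdeg k) * ?s k)"
    unfolding derivation_sum[OF derivation_mp_deriv] sum_distrib_left euler_single[symmetric]
    by (rule sum.swap)
  also have "\<dots> = (\<Sum>k\<in>Poly_Mapping.keys p. of_nat d * ?s k)"
    using assms by (intro sum.cong refl) (simp add: mp_homogeneous_def)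
  finally show ?thesis
    by (simp add: poly_mapping_eq_sum_single flip: sum_distrib_left)
qed

lemma mp_homogeneous_deriv:
  assumes "mp_homogeneous (Suc d) p"
  shows "mp_homogeneous d (mp_deriv i p)"
  unfolding mp_homogeneous_def
proof
  fix l assume "l \<in> Poly_Mapping.keys (mp_deriv i p)"
  then obtain k where k: "k \<in> Poly_Mapping.keys p"
    and l: "l \<in> Poly_Mapping.keys (Poly_Mapping.single (k - Poly_Mapping.single i 1)
      (of_nat (Poly_Mapping.lookup k i) * Poly_Mapping.lookup p k))"
    unfolding mp_deriv_def using keys_sum by fast
  then have l: "l = k - Poly_Mapping.single i 1" and "Poly_Mapping.lookup k i \<noteq> 0"
    by (auto split: if_splits intro!: gr0I)
  then have "mdeg l + 1 = mdeg k"
    by (metis diff_single_add mdeg_add mdeg_single)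
  then show "mdeg l = d" using assms k by (simp add: mp_homogeneous_def)
qed

lemma mp_homogeneous_0: "mp_homogeneous 0 p \<longleftrightarrow> p = mp_const (Poly_Mapping.lookup p 0)"
proof
  assume "mp_homogeneous 0 p"
  then have "Poly_Mapping.keys p \<subseteq> {0}" by (auto simp: mp_homogeneous_def mdeg_0_iff)
  then show "p = mp_const (Poly_Mapping.lookup p 0)"
    by (intro poly_mapping_eqI) (auto simp: mp_const_def lookup_single when_def in_keys_iff)
qed (metis empty_iff insert_iff keys_single mdeg_0_iff mp_const_def mp_homogeneous_def)

lemma mp_homogeneous_sum:
  "(\<And>i. i \<in> A \<Longrightarrow> mp_homogeneous d (f i)) \<Longrightarrow> mp_homogeneous d (sum f A)"
  using keys_sum[of f A] by (fastforce simp: mp_homogeneous_def)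

lemma mp_homogeneous_mult:
  "mp_homogeneous d p \<Longrightarrow> mp_homogeneous d' q \<Longrightarrow> mp_homogeneous (d + d') (p * q)"
  using keys_mult[of p q] by (fastforce simp: mp_homogeneous_def mdeg_add)

lemma mp_homogeneous_const: "mp_homogeneous 0 (mp_const c)"
  by (simp add: mp_homogeneous_def mp_const_def mdeg_0_iff)

lemma mp_homogeneous_var: "mp_homogeneous 1 (mp_var i)"
  by (simp add: mp_homogeneous_def mp_var_def mdeg_single)

text \<open>Rational scalars enter the proof here and through the factor 1/6 in
  \<open>cubic_form\<close>; elsewhere integers are cancelled.\<close>

lemma torsion_free_rat_algebra:
  fixes scale :: "rat \<Rightarrow> 'a::comm_ring_1 \<Rightarrow> 'a"
  assumes "rat_comm_algebra scale"
  shows "torsion_free TYPE('a)"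
proof -
  interpret rat_comm_algebra scale by fact
  have of_nat: "scale (of_nat n) s = of_nat n * s" for n s
    by (induction n) (simp_all add: scale_left_distrib ring_distribs)
  show ?thesis unfolding torsion_free_def
  proof (intro allI impI)
    fix n and s :: 'a assume n: "0 < n" and "of_nat n * s = 0"
    then have "scale (1 / of_nat n) (scale (of_nat n) s) = 0" by (simp add: of_nat)
    then show "s = 0" using n by simp
  qed
qed

lemma torsion_free_mpoly:
  assumes "torsion_free TYPE('a::comm_ring_1)"
  shows "torsion_free TYPE(('n, 'a) mpoly)"
  unfolding torsion_free_def
proof (intro allI impI)
  fix n and p :: "('n, 'a) mpoly" assume n: "0 < n" and 0: "of_nat n * p = 0"
  have "Poly_Mapping.lookup (of_nat n * p) k = of_nat n * Poly_Mapping.lookup p k" for n k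
    by (induction n) (simp_all add: ring_distribs lookup_add)
  then have "Poly_Mapping.lookup p k = 0" for k
    using assms n 0 unfolding torsion_free_def by (metis lookup_zero)
  then show "p = 0" by (intro poly_mapping_eqI) simp
qed

lemma torsion_free_fps:
  assumes "torsion_free TYPE('a::comm_ring_1)"
  shows "torsion_free TYPE('a fps)"
  unfolding torsion_free_def
proof (intro allI impI)
  fix n and p :: "'a fps" assume n: "0 < n" and 0: "of_nat n * p = 0"
  have "fps_nth (of_nat n * p) k = of_nat n * fps_nth p k" for n k
    by (induction n) (simp_all add: ring_distribs)
  then have "fps_nth p k = 0" for k
    using assms n 0 unfolding torsion_free_def by (metis fps_zero_nth)
  then show "p = 0" by (intro fps_ext) simp
qed

section \<open>The cubic form of a homogeneous gradient map\<close>

text \<open>The coefficients are normalised third partial derivatives. Symmetry in the last three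
  indices is commutation of partials; in the first two it is symmetry of the Jacobian.\<close>

theorem cubic_form:
  fixes scale :: "rat \<Rightarrow> 'a::comm_ring_1 \<Rightarrow> 'a" and H :: "('n::finite, 'a) polymap"
  assumes alg: "rat_comm_algebra scale"
    and hom: "\<And>i. mp_homogeneous 3 (H $ i)"
    and sym: "\<And>i j. mp_deriv j (H $ i) = mp_deriv i (H $ j)"
  obtains c :: "'n \<Rightarrow> 'n \<Rightarrow> 'n \<Rightarrow> 'n \<Rightarrow> 'a" where "symmetric_form c"
    "\<And>i. H $ i = (\<Sum>j\<in>UNIV. \<Sum>k\<in>UNIV. \<Sum>l\<in>UNIV. mp_const (c i j k l) * (mp_var j * (mp_var k * mp_var l)))"
    "\<And>i j. mp_deriv j (H $ i) = 3 * (\<Sum>k\<in>UNIV. \<Sum>l\<in>UNIV. mp_const (c i j k l) * (mp_var k * mp_var l))"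
proof -
  interpret rat_comm_algebra scale by fact
  note tf = torsion_free_mpoly[OF torsion_free_rat_algebra[OF alg], where 'n = 'n]
  define T where "T i j k l = mp_deriv l (mp_deriv k (mp_deriv j (H $ i)))" for i j k l
  \<comment> \<open>Third derivatives of a cubic carry the factor 3! = 6.\<close>
  define c where "c i j k l = scale (1/6) (Poly_Mapping.lookup (T i j k l) 0)" for i j k l
  have sixth: "s = 6 * scale (1/6) s" for s
    using scale_left_distrib[of "1/6" "5/6" s] scale_left_distrib[of "1/6" "4/6" s]
      scale_left_distrib[of "1/6" "3/6" s] scale_left_distrib[of "1/6" "2/6" s]
      scale_left_distrib[of "1/6" "1/6" s] by simp
  have T: "T i j k l = 6 * mp_const (c i j k l)" for i j k l
  proof -
    have "mp_homogeneous 0 (T i j k l)"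
      unfolding T_def using hom[of i] by (intro mp_homogeneous_deriv) (simp add: numeral_3_eq_3)
    then have "T i j k l = mp_const (6 * c i j k l)"
      unfolding c_def using sixth by (metis mp_homogeneous_0)
    then show ?thesis
      using ring_hom_on_mult[OF ring_hom_on_mp_const, of 6 "c i j k l"]
      by (simp add: mp_const_def flip: single_numeral)
  qed
  \<comment> \<open>Integration back to \<open>H\<close>: Euler's identity in degrees 1, 2 and 3,
    cancelling the degree each time.\<close>
  have H2: "mp_deriv k (mp_deriv j (H $ i)) = 6 * (\<Sum>l\<in>UNIV. mp_const (c i j k l) * mp_var l)" for i j k
    using euler[OF mp_homogeneous_deriv[of "Suc 0", OF mp_homogeneous_deriv], of "H $ i" k j] hom[of i]
    by (simp add: numeral_3_eq_3 T[unfolded T_def] sum_distrib_left ac_simps)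
  have H1: "mp_deriv j (H $ i) = 3 * (\<Sum>k\<in>UNIV. \<Sum>l\<in>UNIV. mp_const (c i j k l) * (mp_var k * mp_var l))" (is "_ = 3 * ?q") for i j
  proof -
    have "2 * mp_deriv j (H $ i) = 6 * ?q"
      using euler[OF mp_homogeneous_deriv[of 2], of "H $ i" j] hom[of i]
      by (simp add: H2 sum_distrib_left ac_simps)
    then have "2 * (mp_deriv j (H $ i) - 3 * ?q) = 0" by (simp add: right_diff_distrib)
    from torsion_free_numeralD[OF tf this] show ?thesis by simp
  qed
  have H0: "H $ i = (\<Sum>j\<in>UNIV. \<Sum>k\<in>UNIV. \<Sum>l\<in>UNIV. mp_const (c i j k l) * (mp_var j * (mp_var k * mp_var l)))" (is "_ = ?q") for i
  proof -
    have "3 * (H $ i) = 3 * ?q"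
      using euler[OF hom[of i]] by (simp add: H1 sum_distrib_left ac_simps)
    then have "3 * (H $ i - ?q) = 0" by (simp add: right_diff_distrib)
    from torsion_free_numeralD[OF tf this] show ?thesis by simp
  qed
  have "symmetric_form c"
  proof
    show "c i j k l = c j i k l" for i j k l
      by (simp add: c_def T_def sym[of j i])
    show "c i j k l = c i k j l" for i j k l
      unfolding c_def T_def by (simp only: mp_deriv_commute[of k j])
    show "c i j k l = c i j l k" for i j k l
      unfolding c_def T_def by (simp only: mp_deriv_commute[of l k])
  qed
  then show ?thesis using that H0 H1 by blast
qed

lemma symmetric_form_hom: "symmetric_form c \<Longrightarrow> symmetric_form (\<lambda>i j k l. \<phi> (c i j k l))"
  unfolding symmetric_form_def by metis

context
  fixes c :: "'n::finite \<Rightarrow> 'n \<Rightarrow> 'n \<Rightarrow> 'n \<Rightarrow> 'a::comm_ring_1" and H :: "('n, 'a) polymap"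
    and \<phi> :: "'a \<Rightarrow> 's::comm_ring_1"
  assumes c: "symmetric_form c"
    and H: "\<And>i. H $ i = (\<Sum>j\<in>UNIV. \<Sum>k\<in>UNIV. \<Sum>l\<in>UNIV. mp_const (c i j k l) * (mp_var j * (mp_var k * mp_var l)))"
    and \<phi>: "ring_hom_on \<phi>"
begin

interpretation symmetric_form "\<lambda>i j k l. \<phi> (c i j k l)"
  by (rule symmetric_form_hom[OF c])

lemmas eval_simps = ring_hom_on_sum[OF ring_hom_on_mp_eval[OF \<phi>]]
  mp_eval_mult[OF \<phi>] mp_eval_const[OF \<phi>] mp_eval_var[OF \<phi>]

lemma mp_eval_H: "mp_eval \<phi> v (H $ i) = tri v v v $ i"
  by (simp add: H tri_def eval_simps)

text \<open>Evaluation is a ring homomorphism, so it carries (JH)^4 = 0 to the matrix of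
  \<open>3 *s tri v v w\<close> as a map of \<open>w\<close>.\<close>

lemma nilpotent_tri:
  assumes DH: "\<And>i j. mp_deriv j (H $ i) = 3 * (\<Sum>k\<in>UNIV. \<Sum>l\<in>UNIV. mp_const (c i j k l) * (mp_var k * mp_var l))"
    and tf: "torsion_free TYPE('s)"
    and nil: "jacobian H ** jacobian H ** jacobian H ** jacobian H = 0"
  shows "tri v v (tri v v (tri v v (tri v v w))) = 0"
proof -
  define M :: "'s^'n^'n" where "M = map_vec (map_vec (mp_eval \<phi> v)) (jacobian H)"
  have M: "M *v w = 3 *s tri v v w" for w
  proof -
    have 3: "mp_eval \<phi> v 3 = 3"
      using mp_eval_add[OF \<phi>, of v 1] ring_hom_on_1[OF ring_hom_on_mp_eval[OF \<phi>, of v]]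
      by (metis numeral_One one_add_one numeral_plus_one semiring_norm(5) numeral_3_eq_3 add.commute)
    have "(M *v w) $ i = (3 *s tri w v v) $ i" for i
      by (simp add: M_def matrix_vector_mult_def jacobian_def DH eval_simps 3 tri_def
          sum_distrib_left sum_distrib_right ac_simps)
    then show ?thesis by (metis vec_eq_iff tri_commute tri_swap)
  qed
  have hom: "map_vec (map_vec (mp_eval \<phi> v)) (A ** B)
      = map_vec (map_vec (mp_eval \<phi> v)) A ** map_vec (map_vec (mp_eval \<phi> v)) B"
    for A B :: "(('n, 'a) mpoly)^'n^'n"
    by (simp add: vec_eq_iff matrix_matrix_mult_def eval_simps)
  have "M ** M ** M ** M = map_vec (map_vec (mp_eval \<phi> v)) 0"
    by (simp only: M_def hom[symmetric] nil)
  also have "\<dots> = 0"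
    by (simp add: vec_eq_iff ring_hom_on_0[OF ring_hom_on_mp_eval[OF \<phi>]])
  finally have "M *v (M *v (M *v (M *v w))) = 0"
    by (simp add: matrix_vector_mul_assoc matrix_mul_assoc)
  \<comment> \<open>81 = 3^4.\<close>
  then have "81 *s tri v v (tri v v (tri v v (tri v v w))) = 0"
    by (simp add: M vector_smult_assoc)
  then show ?thesis
    by (simp add: vec_eq_iff) (metis torsion_free_numeralD[OF tf])
qed

end

section \<open>The formal inverse as a series in time\<close>

text \<open>The recursion is the triple Cauchy product: these are the t-coefficients of the solution
  of x = X + t{x,x,x}.\<close>

fun inverse_coeff :: "('n \<Rightarrow> 'n \<Rightarrow> 'n \<Rightarrow> 'n \<Rightarrow> 'a) \<Rightarrow> nat \<Rightarrow> 'n::finite \<Rightarrow> ('n, 'a::comm_ring_1) mpoly" where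
  "inverse_coeff c 0 i = mp_var i"
| "inverse_coeff c (Suc m) i = (\<Sum>j\<in>UNIV. \<Sum>k\<in>UNIV. \<Sum>l\<in>UNIV. mp_const (c i j k l) *
    (\<Sum>p=0..m. inverse_coeff c p j *
      (\<Sum>q=0..m - p. inverse_coeff c q k * inverse_coeff c (m - p - q) l)))"

lemma mp_homogeneous_inverse_coeff: "mp_homogeneous (2 * m + 1) (inverse_coeff c m i)"
proof (induction m arbitrary: i rule: less_induct)
  case (less m)
  show ?case
  proof (cases m)
    case 0
    then show ?thesis using mp_homogeneous_var[of i] by simp
  next
    case (Suc n)
    have "mp_homogeneous (2 * m + 1) (mp_const (c i j k l) * (inverse_coeff c p j *
        (inverse_coeff c q k * inverse_coeff c (n - p - q) l)))" if "p \<le> n" "q \<le> n - p" for j k l p q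
    proof -
      have "mp_homogeneous (0 + ((2 * p + 1) + ((2 * q + 1) + (2 * (n - p - q) + 1))))
        (mp_const (c i j k l) * (inverse_coeff c p j * (inverse_coeff c q k * inverse_coeff c (n - p - q) l)))"
        using Suc that by (intro mp_homogeneous_mult mp_homogeneous_const less) auto
      moreover have "0 + ((2 * p + 1) + ((2 * q + 1) + (2 * (n - p - q) + 1))) = 2 * m + 1"
        using that Suc by simp
      ultimately show ?thesis by simp
    qed
    then show ?thesis
      unfolding Suc inverse_coeff.simps sum_distrib_left
      by (intro mp_homogeneous_sum) auto
  qed
qed

text \<open>Each differentiation shifts a coefficient down by one and multiplies it by a positive
  integer, which can be cancelled.\<close>

lemma fps_deriv_funpow_eq_0:
  assumes tf: "torsion_free TYPE('s::comm_ring_1)"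
    and "(fps_deriv ^^ k) (s :: 's fps) = 0" and "k \<le> m"
  shows "fps_nth s m = 0"
  using assms(2,3)
proof (induction k arbitrary: s m)
  case (Suc k)
  then obtain m' where m: "m = Suc m'" "k \<le> m'" by (cases m) auto
  have "fps_nth (fps_deriv s) m' = 0"
    using Suc m by (simp add: funpow_swap1 del: fps_deriv_nth funpow.simps add: funpow_Suc_right)
  then have "of_nat (Suc m') * fps_nth s (Suc m') = 0" by simp
  then show ?case using tf m unfolding torsion_free_def by blast
qed simp

text \<open>The partial derivative in the \<open>j\<close>-th variable with time held fixed.\<close>

definition fps_map_deriv :: "'n \<Rightarrow> ('n, 'a::comm_ring_1) mpoly fps \<Rightarrow> ('n, 'a) mpoly fps" where
  "fps_map_deriv j s = Abs_fps (\<lambda>m. mp_deriv j (fps_nth s m))"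

lemma derivation_fps_map_deriv:
  "derivation (fps_map_deriv j :: ('n, 'a::comm_ring_1) mpoly fps \<Rightarrow> _)"
  unfolding derivation_def fps_map_deriv_def
  by (intro conjI allI fps_ext)
    (simp_all add: derivation_add[OF derivation_mp_deriv] derivation_mult[OF derivation_mp_deriv]
      derivation_sum[OF derivation_mp_deriv] fps_mult_nth sum.distrib)

lemma fps_map_deriv_const: "fps_map_deriv j (fps_const p) = fps_const (mp_deriv j p)"
  unfolding fps_map_deriv_def
  by (intro fps_ext) (simp add: derivation_0[OF derivation_mp_deriv])

lemma fps_map_deriv_X: "fps_map_deriv j fps_X = 0"
  unfolding fps_map_deriv_def
  by (intro fps_ext) (simp add: derivation_0[OF derivation_mp_deriv]
      derivation_1[OF derivation_mp_deriv] fps_X_def)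

lemma derivation_fps_deriv: "derivation (fps_deriv :: 's::comm_ring_1 fps \<Rightarrow> _)"
  by (simp add: derivation_def add.commute)

lemma derivation_combination:
  assumes "\<And>j. derivation (\<delta> j)"
  shows "derivation (\<lambda>s. \<Sum>j\<in>UNIV. v j * \<delta> j s)"
  unfolding derivation_def
  by (simp add: derivation_add[OF assms] derivation_mult[OF assms] ring_distribs sum.distrib
      sum_distrib_left sum_distrib_right ac_simps)

locale cubic_inversion =
  fixes C :: "'n::finite \<Rightarrow> 'n \<Rightarrow> 'n \<Rightarrow> 'n \<Rightarrow> 'a::comm_ring_1"
  assumes C: "symmetric_form C" and tf: "torsion_free TYPE('a)"
begin

definition T :: "'n \<Rightarrow> 'n \<Rightarrow> 'n \<Rightarrow> 'n \<Rightarrow> ('n, 'a) mpoly fps" where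
  "T i j k l = fps_const (mp_const (C i j k l))"

definition x :: "(('n, 'a) mpoly fps)^'n" where
  "x = (\<chi> i. Abs_fps (\<lambda>m. inverse_coeff C m i))"

sublocale symmetric_form T
  unfolding T_def by (rule symmetric_form_hom[OF C])

lemma x_eq: "x $ i = fps_const (mp_var i) + fps_X * tri x x x $ i"
proof (rule fps_ext)
  fix m
  have "fps_nth (tri x x x $ i) m = inverse_coeff C (Suc m) i" for m
    by (simp add: tri_def T_def fps_sum_nth x_def) (simp add: fps_mult_nth)
  then show "fps_nth (x $ i) m = fps_nth (fps_const (mp_var i) + fps_X * tri x x x $ i) m"
    by (cases m) (simp_all add: x_def)
qed

text \<open>Implicit differentiation of the fixed point equation \<open>x_eq\<close>.\<close>

lemma map_vec_x:
  assumes "derivation \<delta>" "\<forall>i j k l. \<delta> (T i j k l) = 0"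
  shows "map_vec \<delta> x = (\<chi> i. \<delta> (fps_const (mp_var i))) + \<delta> fps_X *s tri x x x
    + (3 * fps_X) *s tri x x (map_vec \<delta> x)"
proof -
  have "\<delta> (x $ i) = \<delta> (fps_const (mp_var i)) + \<delta> fps_X * tri x x x $ i + fps_X * map_vec \<delta> (tri x x x) $ i" for i
    by (subst x_eq) (simp add: derivation_add[OF assms(1)] derivation_mult[OF assms(1)])
  moreover have "map_vec \<delta> (tri x x x) = 3 *s tri x x (map_vec \<delta> x)"
    by (simp add: map_vec_tri[OF assms] tri_swap[of x "map_vec \<delta> x" x] tri_commute[of "map_vec \<delta> x" x]
        vec_eq_iff)
  ultimately show ?thesis by (simp add: vec_eq_iff algebra_simps)
qed

text \<open>The vector field that moves the initial point X in direction \<open>v\<close>, with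
  coefficients allowed to depend on X and on time.\<close>

definition base_derivation where
  "base_derivation v s = (\<Sum>j\<in>UNIV. v $ j * fps_map_deriv j s)"

lemma base_derivation:
  "derivation (base_derivation v)" "\<forall>i j k l. base_derivation v (T i j k l) = 0"
  "base_derivation v fps_X = 0" "base_derivation v (fps_const (mp_var i)) = v $ i"
  by (auto simp: base_derivation_def[abs_def] T_def fps_map_deriv_const mp_deriv_const fps_map_deriv_X
      mp_deriv_var if_distrib cong: if_cong intro!: derivation_combination derivation_fps_map_deriv)

end

locale nilpotent_cubic_inversion = cubic_inversion +
  assumes nil: "tri x x (tri x x (tri x x (tri x x v))) = 0"
begin

sublocale nilpotent_form T x
  by standard (use tf nil torsion_free_fps torsion_free_mpoly in blast)+

sublocale nilpotent_quartic T x
proof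
  fix w
  \<comment> \<open>The derivation of direction \<open>v\<close> maps \<open>x\<close> to the solution \<open>u\<close> of \<open>u = v + 3tLu\<close>.\<close>
  define v where "v = w - (3 * fps_X) *s L w"
  define u where "u = map_vec (base_derivation v) x"
  have "u = v + (3 * fps_X) *s L u"
    using map_vec_x[OF base_derivation(1,2), of v]
    by (simp add: base_derivation u_def L_def vec_eq_iff)
  \<comment> \<open>The difference solves the homogeneous equation, so the resolvent formula makes
    it 0.\<close>
  then have "u - w = 0 + (3 * fps_X) *s L (u - w)"
    unfolding v_def by (simp add: vec_eq_iff algebra_simps)
  from resolvent[OF this] have "u = w" by simp
  then show "\<exists>\<delta>. derivation \<delta> \<and> (\<forall>i j k l. \<delta> (T i j k l) = 0) \<and> map_vec \<delta> x = w"
    using base_derivation u_def by blast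
qed

lemma map_vec_fps_deriv_x:
  "map_vec fps_deriv x = a + (3 * fps_X) *s b + (9 * fps_X^2) *s c"
proof -
  have "map_vec fps_deriv x = L x + (3 * fps_X) *s L (map_vec fps_deriv x)"
    using map_vec_x[OF derivation_fps_deriv]
    by (simp add: T_def L_def vec_eq_iff)
  from resolvent[OF this] show ?thesis
    by (simp add: Lx La Lb power_mult_distrib)
qed

text \<open>The inverse of \<open>1 - 3tL\<close> is self-adjoint, so it can be moved from the unit
  vector to \<open>a\<close>. The outcome 6(b + 3tc) is twice the time derivative of
  \<open>a\<close>.\<close>

lemma fps_map_deriv_inner_a_a: "fps_map_deriv j (a \<bullet>\<bullet> a) = 2 * map_vec fps_deriv a $ j"
proof -
  define u where "u = map_vec (fps_map_deriv j) x"
  have T0: "\<forall>i k l m. fps_map_deriv j (T i k l m) = 0"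
    by (simp add: T_def fps_map_deriv_const mp_deriv_const)
  have "u = axis j 1 + (3 * fps_X) *s L u"
    using map_vec_x[OF derivation_fps_map_deriv T0]
    by (simp add: fps_map_deriv_const fps_map_deriv_X mp_deriv_var u_def L_def vec_eq_iff axis_def)
  from resolvent[OF this] have u: "L u = L (axis j 1) + (3 * fps_X) *s L (L (axis j 1))
      + (3 * fps_X)^2 *s L (L (L (axis j 1)))"
    by (metis L_simps(1,4,6) add.right_neutral vector_smult_rzero)
  have "fps_map_deriv j (a \<bullet>\<bullet> a) = 6 * (L u \<bullet>\<bullet> a)"
    by (simp add: derivation_inner_vec[OF derivation_fps_map_deriv] inner_vec_commute[of a "L u"]
        map_vec_a[OF derivation_fps_map_deriv T0 u_def[symmetric]])
  also have "L u \<bullet>\<bullet> a = (b + (3 * fps_X) *s c) $ j"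
    unfolding u by (simp add: L_inner La Lb inner_vec_axis)
  also have "6 * \<dots> = 2 * map_vec fps_deriv a $ j"
    using sixth_derivative_inner_a_a(2)[OF derivation_fps_deriv _ fps_deriv_fps_X map_vec_fps_deriv_x]
    by (simp add: T_def algebra_simps)
  finally show ?thesis .
qed

theorem inverse_coeff_eq_0:
  assumes "8 \<le> m"
  shows "inverse_coeff C m j = 0"
proof -
  note tf' = torsion_free_mpoly[OF tf, where 'n = 'n]
  \<comment> \<open>One shift is the time derivative of \<open>a\<close>, the other the factor t in
    x = X + ta; the vanishing from t^6 on thus reaches \<open>x\<close> at t^8.\<close>
  obtain n where m: "m = Suc (Suc n)" and n: "6 \<le> n"
    by (rule that[of "m - 2"]) (use assms in auto)
  have "(fps_deriv ^^ 6) (a \<bullet>\<bullet> a) = 0"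
    by (rule sixth_derivative_inner_a_a(1)[OF derivation_fps_deriv _ fps_deriv_fps_X map_vec_fps_deriv_x])
      (simp add: T_def)
  then have "fps_nth (a \<bullet>\<bullet> a) n = 0"
    by (rule fps_deriv_funpow_eq_0[OF tf' _ n])
  then have "fps_nth (fps_map_deriv j (a \<bullet>\<bullet> a)) n = 0"
    by (simp add: fps_map_deriv_def derivation_0[OF derivation_mp_deriv])
  then have "2 * (of_nat (Suc n) * fps_nth (a $ j) (Suc n)) = 0"
    by (simp add: fps_map_deriv_inner_a_a numeral_fps_const)
  then have "of_nat (Suc n) * fps_nth (a $ j) (Suc n) = 0"
    by (rule torsion_free_numeralD[OF tf'])
  then have "fps_nth (a $ j) (Suc n) = 0"
    using tf' unfolding torsion_free_def by blast
  moreover have "fps_nth (x $ j) m = fps_nth (a $ j) (Suc n)"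
    by (subst x_eq) (simp add: m a_def L_def)
  ultimately show ?thesis by (simp add: x_def)
qed

end

section \<open>Uniqueness of the formal inverse\<close>

lemma ring_hom_on_mp_eval_comp:
  assumes "ring_hom_on \<psi>"
  shows "\<psi> (mp_eval \<phi> v p) = mp_eval (\<psi> \<circ> \<phi>) (map_vec \<psi> v) p"
  by (simp add: mp_eval_def ring_hom_on_sum[OF assms] ring_hom_on_mult[OF assms]
      ring_hom_on_prod[OF assms] ring_hom_on_power[OF assms])

lemma mps_coeff_simps [simp]:
  "mps_coeff 0 k = 0" "mps_coeff (f + g) k = mps_coeff f k + mps_coeff g k"
  "mps_coeff (f - g) k = mps_coeff f k - mps_coeff g k"
  by (simp_all add: zero_mps_def plus_mps_def minus_mps_def)

lemma mps_coeff_sum: "mps_coeff (sum f A) k = (\<Sum>i\<in>A. mps_coeff (f i) k)"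
  by (induction A rule: infinite_finite_induct) simp_all

lemma mps_coeff_mult: "mps_coeff (f * g) k = (\<Sum>(i, j) | i + j = k. mps_coeff f i * mps_coeff g j)"
  by (simp add: times_mps_def)

lemma mps_coeff_of_mpoly [simp]: "mps_coeff (mps_of_mpoly p) k = Poly_Mapping.lookup p k"
  by (simp add: mps_of_mpoly_def)

lemma mps_of_mpoly_eq_iff: "mps_of_mpoly p = mps_of_mpoly q \<longleftrightarrow> p = q"
  by (metis mps_coeff_of_mpoly poly_mapping_eqI)

lemma mps_coeff_single_mult:
  "mps_coeff (mps_of_mpoly (Poly_Mapping.single k c) * f) (k + l) = c * mps_coeff f l"
proof -
  have "mps_coeff (mps_of_mpoly (Poly_Mapping.single k c) * f) (k + l)
      = (\<Sum>(i, j)\<in>{(k, l)}. c * mps_coeff f l)"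
    unfolding mps_coeff_mult
    by (rule sum.mono_neutral_cong_right) (auto simp: lookup_single when_def split: if_splits)
  then show ?thesis by simp
qed

lemma ring_hom_on_mps_of_mpoly:
  "ring_hom_on (mps_of_mpoly :: ('n::finite, 'a::comm_ring_1) mpoly \<Rightarrow> ('n, 'a) mps)"
proof -
  have add: "mps_of_mpoly (p + q) = mps_of_mpoly p + mps_of_mpoly q" for p q :: "('n, 'a) mpoly"
    by (rule mps_eqI) (simp add: lookup_add)
  have single_mult: "mps_of_mpoly (Poly_Mapping.single k c * Poly_Mapping.single l d)
      = mps_of_mpoly (Poly_Mapping.single k c) * mps_of_mpoly (Poly_Mapping.single l d)"
    for k l :: "'n \<Rightarrow>\<^sub>0 nat" and c d :: 'a
  proof (rule mps_eqI)
    fix m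
    have "(\<Sum>(i, j) | i + j = m. mps_coeff (mps_of_mpoly (Poly_Mapping.single k c)) i
          * mps_coeff (mps_of_mpoly (Poly_Mapping.single l d)) j)
        = (\<Sum>p\<in>{(i, j). i + j = m}. if p = (k, l) then c * d else 0)"
      by (rule sum.cong) (auto simp: lookup_single when_def split: if_splits)
    also have "\<dots> = (if k + l = m then c * d else 0)"
      by (subst sum.delta) auto
    finally show "mps_coeff (mps_of_mpoly (Poly_Mapping.single k c * Poly_Mapping.single l d)) m
        = mps_coeff (mps_of_mpoly (Poly_Mapping.single k c) * mps_of_mpoly (Poly_Mapping.single l d)) m"
      by (simp add: mps_coeff_mult mult_single lookup_single when_def)
  qed
  have "mps_of_mpoly (p * q) = mps_of_mpoly p * mps_of_mpoly q" for p q :: "('n, 'a) mpoly"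
  proof (induction p rule: mpoly_induct)
    case (single k c)
    show ?case by (induction q rule: mpoly_induct) (simp_all add: single_mult add ring_distribs)
  qed (simp add: add ring_distribs)
  moreover have "mps_of_mpoly 1 = (1 :: ('n, 'a) mps)"
    by (rule mps_eqI) (simp add: one_mps_def lookup_one when_def)
  ultimately show ?thesis by (simp add: ring_hom_on_def add)
qed

text \<open>The order is phrased as a lower bound, so that the zero series needs no infinite
  value.\<close>

definition mps_order_ge :: "nat \<Rightarrow> ('n::finite, 'a::comm_ring_1) mps \<Rightarrow> bool" where
  "mps_order_ge d f \<longleftrightarrow> (\<forall>k. mdeg k < d \<longrightarrow> mps_coeff f k = 0)"

lemma mps_order_ge_add: "mps_order_ge d f \<Longrightarrow> mps_order_ge d g \<Longrightarrow> mps_order_ge d (f + g)"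
  by (simp add: mps_order_ge_def)

lemma mps_order_ge_sum: "(\<And>i. i \<in> A \<Longrightarrow> mps_order_ge d (f i)) \<Longrightarrow> mps_order_ge d (sum f A)"
  by (simp add: mps_order_ge_def mps_coeff_sum)

lemma mps_order_ge_mult:
  assumes "mps_order_ge d f" "mps_order_ge d' g"
  shows "mps_order_ge (d + d') (f * g)"
  unfolding mps_order_ge_def mps_coeff_mult
proof (intro allI impI sum.neutral ballI, clarify)
  fix i j :: "'a \<Rightarrow>\<^sub>0 nat" assume "mdeg (i + j) < d + d'"
  then have "mdeg i < d \<or> mdeg j < d'" by (auto simp: mdeg_add)
  then show "mps_coeff f i * mps_coeff g j = 0" using assms by (auto simp: mps_order_ge_def)
qed

lemma mps_order_ge_0: "mps_order_ge 0 f"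
  by (simp add: mps_order_ge_def)

lemma mps_order_ge_power: "mps_order_ge 1 f \<Longrightarrow> mps_order_ge m (f ^ m)"
  by (induction m) (use mps_order_ge_0 mps_order_ge_mult[of 1] in auto)

lemma mps_order_ge_prod:
  "(\<And>i. i \<in> A \<Longrightarrow> mps_order_ge (d i) (f i)) \<Longrightarrow> mps_order_ge (sum d A) (prod f A)"
  by (induction A rule: infinite_finite_induct) (auto simp: mps_order_ge_0 mps_order_ge_mult)

text \<open>The cutoff at \<open>mdeg k\<close> loses nothing: without constant terms in
  \<open>G\<close>, monomials of higher degree do not reach the \<open>k\<close>-th
  coefficient.\<close>

lemma mps_compose_of_mpoly:
  assumes G: "\<And>i. mps_order_ge 1 (G $ i)"
  shows "mps_compose (mps_of_mpoly p) G = mp_eval (mps_of_mpoly \<circ> mp_const) G p"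
proof (rule mps_eqI)
  fix k
  let ?P = "\<lambda>m. \<Prod>i\<in>UNIV. (G $ i) ^ Poly_Mapping.lookup m i"
  let ?t = "\<lambda>m. Poly_Mapping.lookup p m * mps_coeff (?P m) k"
  let ?A = "{m. mdeg m \<le> mdeg k}"
  have A: "?A = (\<Union>d\<le>mdeg k. {m. mdeg m = d})" by auto
  have fin: "finite ?A" unfolding A by (simp add: finite_mdeg_eq)
  have "mps_order_ge (mdeg m) (?P m)" for m
    unfolding mdeg_def by (intro mps_order_ge_prod mps_order_ge_power G)
  then have 0: "?t m = 0" if "m \<notin> ?A" for m
    using that by (simp add: mps_order_ge_def)
  have "mps_coeff (mps_compose (mps_of_mpoly p) G) k = sum ?t ?A"
    by (simp add: mps_compose_def)
  also have "\<dots> = sum ?t (?A \<union> Poly_Mapping.keys p)"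
    using fin 0 by (intro sum.mono_neutral_left) auto
  also have "\<dots> = sum ?t (Poly_Mapping.keys p)"
    using fin by (intro sum.mono_neutral_right) (auto simp: in_keys_iff)
  also have "\<dots> = mps_coeff (mp_eval (mps_of_mpoly \<circ> mp_const) G p) k"
    unfolding mp_eval_def mps_coeff_sum mp_const_def
    by (simp add: mps_coeff_single_mult[of 0 _ _ k, simplified])
  finally show "mps_coeff (mps_compose (mps_of_mpoly p) G) k
      = mps_coeff (mp_eval (mps_of_mpoly \<circ> mp_const) G p) k" .
qed

lemma (in symmetric_form) fixed_point_diff:
  "tri z z z - tri z' z' z' = tri (z - z') z z + tri z' (z - z') z + tri z' z' (z - z')"
  by (simp add: algebra_simps)

text \<open>A contraction argument: telescoping the cubic term writes the difference as products of
  itself with two factors of order at least 1, so its order exceeds every bound.\<close>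

lemma unique_fixed_point:
  fixes C :: "'n::finite \<Rightarrow> 'n \<Rightarrow> 'n \<Rightarrow> 'n \<Rightarrow> ('n, 'a::comm_ring_1) mps"
  assumes "symmetric_form C"
    and z: "z = u + symmetric_form.tri C z z z" "\<And>i. mps_order_ge 1 (z $ i)"
    and z': "z' = u + symmetric_form.tri C z' z' z'" "\<And>i. mps_order_ge 1 (z' $ i)"
  shows "z = z'"
proof -
  interpret symmetric_form C by fact
  have diff: "z - z' = tri (z - z') z z + tri z' (z - z') z + tri z' z' (z - z')"
    unfolding fixed_point_diff[symmetric] by (subst (1) z(1), subst (1) z'(1)) simp
  have tri: "mps_order_ge e (tri v v' v'' $ i)"
    if "e = d + (d' + d'')" and "\<And>i. mps_order_ge d (v $ i)" "\<And>i. mps_order_ge d' (v' $ i)" "\<And>i. mps_order_ge d'' (v'' $ i)"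
    for e d d' d'' v v' v'' i
  proof -
    have "mps_order_ge (0 + (d + (d' + d''))) (C i j k l * (v $ j * (v' $ k * v'' $ l)))" for j k l
      by (intro mps_order_ge_mult mps_order_ge_0 that)
    then show ?thesis by (simp add: tri_def mps_order_ge_sum that(1))
  qed
  have order: "mps_order_ge d ((z - z') $ i)" for d i
  proof (induction d arbitrary: i)
    case (Suc d)
    have "mps_order_ge (d + 2) (tri (z - z') z z $ i)"
      by (rule tri[of "d + 2" d 1 1]) (simp, rule Suc, rule z(2), rule z(2))
    moreover have "mps_order_ge (d + 2) (tri z' (z - z') z $ i)"
      by (rule tri[of "d + 2" 1 d 1]) (simp, rule z'(2), rule Suc, rule z(2))
    moreover have "mps_order_ge (d + 2) (tri z' z' (z - z') $ i)"
      by (rule tri[of "d + 2" 1 1 d]) (simp, rule z'(2), rule z'(2), rule Suc)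
    ultimately have "mps_order_ge (d + 2)
        ((tri (z - z') z z + tri z' (z - z') z + tri z' z' (z - z')) $ i)"
      unfolding vector_add_component by (intro mps_order_ge_add)
    then have "mps_order_ge (d + 2) ((z - z') $ i)"
      by (rule ssubst[OF diff, where P = "\<lambda>v. mps_order_ge (d + 2) (v $ i)"])
    then show ?case by (simp add: mps_order_ge_def)
  qed (rule mps_order_ge_0)
  have "mps_coeff ((z - z') $ i) k = 0" for i k
    using order[of "Suc (mdeg k)" i] by (simp add: mps_order_ge_def)
  then show ?thesis by (simp add: vec_eq_iff) (metis mps_eqI)
qed

lemma ring_hom_on_comp: "ring_hom_on \<phi> \<Longrightarrow> ring_hom_on \<psi> \<Longrightarrow> ring_hom_on (\<psi> \<circ> \<phi>)"
  by (simp add: ring_hom_on_def)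

lemma ring_hom_on_fps_const: "ring_hom_on (fps_const :: 's::comm_ring_1 \<Rightarrow> _)"
  by (simp add: ring_hom_on_def)

text \<open>The value at t = 1 of the time series; under nilpotency nothing is cut off.\<close>

definition truncated_inverse :: "('n \<Rightarrow> 'n \<Rightarrow> 'n \<Rightarrow> 'n \<Rightarrow> 'a) \<Rightarrow> ('n::finite, 'a::comm_ring_1) polymap" where
  "truncated_inverse C = (\<chi> i. \<Sum>m\<le>7. inverse_coeff C m i)"

text \<open>The series \<open>x\<close> is a polynomial in the formal variable, so its fixed point equation may be
  evaluated at \<open>1\<close>.\<close>

lemma (in nilpotent_cubic_inversion) truncated_inverse_eq:
  "truncated_inverse C $ i = mp_var i + (\<Sum>j\<in>UNIV. \<Sum>k\<in>UNIV. \<Sum>l\<in>UNIV. mp_const (C i j k l) *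
    (truncated_inverse C $ j * (truncated_inverse C $ k * truncated_inverse C $ l)))"
proof -
  define P where "P i = (\<Sum>m\<le>7. monom (inverse_coeff C m i) m)" for i
  have P: "fps_of_poly (P i) = x $ i" for i
  proof (rule fps_ext)
    fix m
    show "fps_nth (fps_of_poly (P i)) m = fps_nth (x $ i) m"
      by (cases "m \<le> 7") (simp_all add: P_def coeff_sum x_def inverse_coeff_eq_0)
  qed
  have poly: "poly (P i) 1 = truncated_inverse C $ i" for i
    by (simp add: P_def poly_sum poly_monom truncated_inverse_def)
  have "fps_of_poly (P i) = fps_of_poly ([:mp_var i:] + [:0, 1:] * (\<Sum>j\<in>UNIV. \<Sum>k\<in>UNIV. \<Sum>l\<in>UNIV.
      [:mp_const (C i j k l):] * (P j * (P k * P l))))"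
    using x_eq[of i]
    by (simp only: fps_of_poly_add fps_of_poly_mult fps_of_poly_sum fps_of_poly_const
        fps_of_poly_fps_X P tri_def T_def vec_lambda_beta)
  then have "P i = [:mp_var i:] + [:0, 1:] * (\<Sum>j\<in>UNIV. \<Sum>k\<in>UNIV. \<Sum>l\<in>UNIV.
      [:mp_const (C i j k l):] * (P j * (P k * P l)))"
    by (simp only: fps_of_poly_eq_iff)
  then have "poly (P i) 1 = poly ([:mp_var i:] + [:0, 1:] * (\<Sum>j\<in>UNIV. \<Sum>k\<in>UNIV. \<Sum>l\<in>UNIV.
      [:mp_const (C i j k l):] * (P j * (P k * P l)))) 1"
    by simp
  then show ?thesis
    by (simp add: poly poly_sum)
qed

section \<open>Constant terms and homogeneous parts\<close>

lemma ring_hom_on_id: "ring_hom_on id"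
  by (simp add: ring_hom_on_def)

lemma mp_eval_zero:
  fixes p :: "('n::finite, 'a::comm_ring_1) mpoly"
  shows "mp_eval id 0 p = Poly_Mapping.lookup p 0"
proof (induction p rule: mpoly_induct)
  case (single k c)
  show ?case
  proof (cases "k = 0")
    case False
    then obtain i where "Poly_Mapping.lookup k i \<noteq> 0"
      by (metis lookup_zero poly_mapping_eqI)
    then have "(\<Prod>i\<in>UNIV. (0 :: 'a) ^ Poly_Mapping.lookup k i) = 0"
      by (intro prod_zero) (auto simp: power_0_left)
    then show ?thesis
      using False unfolding mp_eval_single[OF ring_hom_on_id] by (simp add: lookup_single when_def)
  next
    case True
    then show ?thesis unfolding mp_eval_single[OF ring_hom_on_id] by simp
  qed
next
  case (add p q)
  then show ?case unfolding mp_eval_add[OF ring_hom_on_id] lookup_add by (simp only:)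
qed

lemma mps_order_ge_1_of_mpoly: "mps_order_ge 1 (mps_of_mpoly p) \<longleftrightarrow> Poly_Mapping.lookup p 0 = 0"
  by (auto simp: mps_order_ge_def mdeg_0_iff)

lemma lookup_homogeneous: "mp_homogeneous d p \<Longrightarrow> mdeg k \<noteq> d \<Longrightarrow> Poly_Mapping.lookup p k = 0"
  by (auto simp: mp_homogeneous_def in_keys_iff)

lemma lookup_mp_var_0:
  "Poly_Mapping.lookup (mp_var i :: ('n::finite, 'a::comm_ring_1) mpoly) 0 = 0"
  by (rule lookup_homogeneous[OF mp_homogeneous_var]) (simp add: mdeg_0_iff[THEN iffD2])

lemma lookup_mps_hom_part:
  "Poly_Mapping.lookup (mps_hom_part d f) k = (if mdeg k = d then mps_coeff f k else 0)"
  by (simp add: mps_hom_part_def lookup_sum lookup_single when_def sum.delta[OF finite_mdeg_eq])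

context
  fixes C :: "'n::finite \<Rightarrow> 'n \<Rightarrow> 'n \<Rightarrow> 'n \<Rightarrow> 'a::comm_ring_1" and F H :: "('n, 'a) polymap"
  assumes C: "symmetric_form C"
    and H: "\<And>i. H $ i = (\<Sum>j\<in>UNIV. \<Sum>k\<in>UNIV. \<Sum>l\<in>UNIV. mp_const (C i j k l) * (mp_var j * (mp_var k * mp_var l)))"
    and F: "F = polymap_id - H"
    and nilpotent: "nilpotent_cubic_inversion C"
begin

lemma mp_eval_F:
  assumes "ring_hom_on \<phi>"
  shows "mp_eval \<phi> v (F $ i) = v $ i - symmetric_form.tri (\<lambda>i j k l. \<phi> (C i j k l)) v v v $ i"
  by (simp add: F polymap_id_def ring_hom_on_diff[OF ring_hom_on_mp_eval[OF assms]]
      mp_eval_var[OF assms] mp_eval_H[OF C H assms])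

lemma lookup_truncated_inverse_0: "Poly_Mapping.lookup (truncated_inverse C $ i) 0 = 0"
  by (simp add: truncated_inverse_def lookup_sum mdeg_0_iff[THEN iffD2]
      lookup_homogeneous[OF mp_homogeneous_inverse_coeff])

text \<open>At t = 1 the fixed point equation reads P - {P,P,P} = X, which is F(P) = X.\<close>

lemma right_inverse: "polymap_compose F (truncated_inverse C) = polymap_id"
proof -
  have "mp_eval mp_const (truncated_inverse C) (F $ i) = mp_var i" for i
    unfolding mp_eval_F[OF ring_hom_on_mp_const] symmetric_form.tri_def[OF symmetric_form_hom[OF C]]
      vec_lambda_beta diff_eq_eq
    by (rule nilpotent_cubic_inversion.truncated_inverse_eq[OF nilpotent])
  then show ?thesis
    by (simp add: vec_eq_iff polymap_compose_def mp_compose_eq_mp_eval polymap_id_def)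
qed

abbreviation (input) "mps_const \<equiv> mps_of_mpoly \<circ> (mp_const :: 'a \<Rightarrow> ('n, 'a) mpoly)"

lemma ring_hom_on_mps_const: "ring_hom_on mps_const"
  by (rule ring_hom_on_comp[OF ring_hom_on_mp_const ring_hom_on_mps_of_mpoly])

text \<open>F is injective on series tuples without constant term, since F(z) = u means z = u +
  {z,z,z}.\<close>

lemma fixed_point_unique:
  assumes "\<And>i. mp_eval mps_const z (F $ i) = mp_eval mps_const z' (F $ i)"
    and "\<And>i. mps_order_ge 1 (z $ i)" "\<And>i. mps_order_ge 1 (z' $ i)"
  shows "z = z'"
proof -
  let ?tri = "symmetric_form.tri (\<lambda>i j k l. mps_const (C i j k l))"
  define u where "u = z - ?tri z z z"
  have u: "u = z' - ?tri z' z' z'"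
    using assms(1) by (simp add: u_def vec_eq_iff mp_eval_F[OF ring_hom_on_mps_const])
  have "z = u + ?tri z z z" by (simp add: u_def)
  moreover have "z' = u + ?tri z' z' z'" by (simp add: u)
  ultimately show ?thesis
    using unique_fixed_point[OF symmetric_form_hom[OF C]] assms(2,3) by blast
qed

lemma mps_of_mpoly_compose:
  "mps_of_mpoly (mp_eval mp_const P p) = mp_eval mps_const (map_vec mps_of_mpoly P) p"
  by (rule ring_hom_on_mp_eval_comp[OF ring_hom_on_mps_of_mpoly])

lemma lookup_F_0: "Poly_Mapping.lookup (F $ i) 0 = 0"
proof -
  have "mp_eval id 0 (F $ i) = 0"
    using mp_eval_F[OF ring_hom_on_id, of 0 i] symmetric_form.tri_simps1(5)[OF C] by simp
  then show ?thesis by (simp only: mp_eval_zero)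
qed

text \<open>The right inverse gives F(E) = F for the other composite E, and E has no constant term;
  injectivity of F on series then forces E = X.\<close>

lemma left_inverse: "polymap_compose (truncated_inverse C) F = polymap_id"
proof -
  let ?E = "polymap_compose (truncated_inverse C) F"
  have "polymap_compose F ?E = F"
    by (simp add: right_inverse polymap_compose_id flip: polymap_compose_assoc)
  then have FE: "mp_eval mp_const ?E (F $ i) = F $ i" for i
    by (metis polymap_compose_def mp_compose_eq_mp_eval vec_lambda_beta)
  have E0: "Poly_Mapping.lookup (?E $ i) 0 = 0" for i
  proof -
    have 0: "map_vec (mp_eval id 0) F = 0"
      by (simp add: vec_eq_iff mp_eval_zero lookup_F_0)
    have "mp_eval id 0 (?E $ i) = 0"
      by (simp add: polymap_compose_def mp_compose_eq_mp_eval mp_eval_mp_eval[OF ring_hom_on_id] 0)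
        (simp add: mp_eval_zero lookup_truncated_inverse_0)
    then show ?thesis by (simp only: mp_eval_zero)
  qed
  have "map_vec mps_of_mpoly ?E = map_vec mps_of_mpoly polymap_id"
  proof (rule fixed_point_unique)
    show "mp_eval mps_const (map_vec mps_of_mpoly ?E) (F $ i) = mp_eval mps_const (map_vec mps_of_mpoly polymap_id) (F $ i)" for i
      by (simp only: mps_of_mpoly_compose[symmetric] FE mp_eval_id)
    show "mps_order_ge 1 (map_vec mps_of_mpoly ?E $ i)" for i
      by (simp only: map_vec_component mps_order_ge_1_of_mpoly E0)
    show "mps_order_ge 1 (map_vec mps_of_mpoly polymap_id $ i)" for i
      by (simp only: map_vec_component mps_order_ge_1_of_mpoly)
        (simp add: polymap_id_def lookup_mp_var_0)
  qed
  then show ?thesis by (simp add: vec_eq_iff mps_of_mpoly_eq_iff)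
qed

lemma is_polymap_inverse_truncated_inverse: "is_polymap_inverse F (truncated_inverse C)"
  by (simp add: is_polymap_inverse_def right_inverse left_inverse)

text \<open>The polynomial inverse is itself a formal inverse. Any other one, Z, also satisfies F(Z)
  = X, so injectivity of F identifies the two.\<close>

lemma formal_inverse_eq: "formal_inverse F = seriesmap_of_polymap (truncated_inverse C)"
  unfolding formal_inverse_def
proof (rule the_equality)
  let ?G = "truncated_inverse C"
  have map_vec: "seriesmap_of_polymap P = map_vec mps_of_mpoly P" for P :: "('n, 'a) polymap"
    by (simp add: seriesmap_of_polymap_def map_vec_def)
  have compose: "seriesmap_compose (seriesmap_of_polymap P) Z = (\<chi> i. mp_eval mps_const Z (P $ i))"
    if "\<And>i. mps_order_ge 1 (Z $ i)" for P and Z :: "('n, 'a) seriesmap"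
    by (simp add: seriesmap_compose_def seriesmap_of_polymap_def mps_compose_of_mpoly[OF that])
  have compose': "seriesmap_compose (seriesmap_of_polymap P) (seriesmap_of_polymap Q)
      = seriesmap_of_polymap (polymap_compose P Q)"
    if "\<And>i. Poly_Mapping.lookup (Q $ i) 0 = 0" for P Q :: "('n, 'a) polymap"
  proof -
    have "mps_order_ge 1 (seriesmap_of_polymap Q $ i)" for i
      using that by (simp add: map_vec mps_order_ge_1_of_mpoly del: One_nat_def)
    from compose[OF this] show ?thesis
      by (simp add: vec_eq_iff map_vec mps_of_mpoly_compose polymap_compose_def mp_compose_eq_mp_eval)
  qed
  have low: "Poly_Mapping.lookup (?G $ i) k = Poly_Mapping.lookup (mp_var i) k" if "mdeg k \<le> 1" for i k
  proof -
    have "Poly_Mapping.lookup (?G $ i) k = (\<Sum>m\<le>7. Poly_Mapping.lookup (inverse_coeff C m i) k)"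
      by (simp add: truncated_inverse_def lookup_sum)
    also have "\<dots> = (\<Sum>m\<in>{0}. Poly_Mapping.lookup (inverse_coeff C m i) k)"
      using that
      by (intro sum.mono_neutral_right)
        (auto intro!: lookup_homogeneous[OF mp_homogeneous_inverse_coeff])
    finally show ?thesis by simp
  qed
  show "is_formal_inverse F (seriesmap_of_polymap ?G)"
    unfolding is_formal_inverse_def
    using low by (simp add: compose' lookup_truncated_inverse_0 lookup_F_0 right_inverse left_inverse)
      (simp add: map_vec)
  fix Z assume Z: "is_formal_inverse F Z"
  have Z1: "mps_order_ge 1 (Z $ i)" for i
  proof -
    have "mdeg (0 :: 'n \<Rightarrow>\<^sub>0 nat) \<le> 1" by (simp add: mdeg_0_iff[THEN iffD2])
    then have "mps_coeff (Z $ i) 0 = Poly_Mapping.lookup (mp_var i :: ('n, 'a) mpoly) 0"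
      using Z unfolding is_formal_inverse_def by blast
    then show ?thesis by (auto simp: mps_order_ge_def mdeg_0_iff lookup_mp_var_0)
  qed
  have G1: "mps_order_ge 1 (seriesmap_of_polymap ?G $ i)" for i
    by (simp add: map_vec mps_order_ge_1_of_mpoly lookup_truncated_inverse_0 del: One_nat_def)
  have "(\<chi> i. mp_eval mps_const Z (F $ i)) = seriesmap_of_polymap polymap_id"
    using Z compose[OF Z1, of F] unfolding is_formal_inverse_def by metis
  also have "\<dots> = (\<chi> i. mp_eval mps_const (seriesmap_of_polymap ?G) (F $ i))"
    using compose[OF G1, of F] compose'[OF lookup_truncated_inverse_0, of F]
    unfolding right_inverse by metis
  finally have "mp_eval mps_const Z (F $ i) = mp_eval mps_const (seriesmap_of_polymap ?G) (F $ i)" for i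
    by (simp only: vec_eq_iff vec_lambda_beta)
  then show "Z = seriesmap_of_polymap ?G"
    by (rule fixed_point_unique[OF _ Z1 G1])
qed

text \<open>The summands have pairwise distinct degrees \<open>2 * m + 1\<close>, so each
  homogeneous part isolates one of them.\<close>

lemma inverse_term_eq:
  assumes "m \<le> 7"
  shows "inverse_term F m $ i = inverse_coeff C m i"
proof (rule poly_mapping_eqI)
  fix k
  note hom = lookup_homogeneous[OF mp_homogeneous_inverse_coeff]
  show "Poly_Mapping.lookup (inverse_term F m $ i) k = Poly_Mapping.lookup (inverse_coeff C m i) k"
  proof (cases "mdeg k = 2 * m + 1")
    case True
    have "Poly_Mapping.lookup (truncated_inverse C $ i) k
        = (\<Sum>m'\<in>{m}. Poly_Mapping.lookup (inverse_coeff C m' i) k)"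
      unfolding truncated_inverse_def lookup_sum vec_lambda_beta
      using True assms by (intro sum.mono_neutral_right) (auto intro!: hom)
    then show ?thesis
      using True
      by (simp add: inverse_term_def lookup_mps_hom_part formal_inverse_eq seriesmap_of_polymap_def)
  next
    case False
    then show ?thesis using hom by (simp add: inverse_term_def lookup_mps_hom_part)
  qed
qed

lemma polymap_inv_eq:
  "polymap_inv F = polymap_id + inverse_term F 1 + inverse_term F 2 + inverse_term F 3
      + inverse_term F 4 + inverse_term F 5 + inverse_term F 6 + inverse_term F 7"
proof -
  have "truncated_inverse C $ i = mp_var i + inverse_coeff C 1 i + inverse_coeff C 2 i
      + inverse_coeff C 3 i + inverse_coeff C 4 i + inverse_coeff C 5 i + inverse_coeff C 6 i
      + inverse_coeff C 7 i" for i
    by (simp add: truncated_inverse_def atMost_Suc eval_nat_numeral add_ac del: inverse_coeff.simps(2))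
  then show ?thesis
    by (simp add: polymap_inv_eqI[OF is_polymap_inverse_truncated_inverse] vec_eq_iff inverse_term_eq polymap_id_def
        del: inverse_coeff.simps(2) One_nat_def)
qed

text \<open>The top summand has degree 2 * 7 + 1 = 15.\<close>

lemma polymap_degree_inv: "polymap_degree (polymap_inv F) \<le> 15"
proof -
  have "mdeg k \<le> 15" if k: "k \<in> Poly_Mapping.keys (truncated_inverse C $ i)" for i k
  proof -
    obtain m where "m \<le> 7" "k \<in> Poly_Mapping.keys (inverse_coeff C m i)"
      using k keys_sum[of "\<lambda>m. inverse_coeff C m i" "{..7}"]
      unfolding truncated_inverse_def vec_lambda_beta by fast
    then show ?thesis
      using mp_homogeneous_inverse_coeff[of m C i] by (auto simp: mp_homogeneous_def)
  qed
  then show ?thesis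
    by (auto simp: polymap_inv_eqI[OF is_polymap_inverse_truncated_inverse] polymap_degree_def mp_degree_def)
qed

end

theorem theorem3p19:
  fixes scale :: "rat \<Rightarrow> 'a::comm_ring_1 \<Rightarrow> 'a"
    and F H :: "('n::finite, 'a) polymap"
  assumes "rat_comm_algebra scale"
    and "F = polymap_id - H"
    and "transpose (jacobian F) = jacobian F"
    and "\<forall>i. mp_homogeneous 3 (H $ i)"
    and "jacobian H ** jacobian H ** jacobian H ** jacobian H = 0"
  shows "polymap_invertible F \<and>
    polymap_inv F = polymap_id + inverse_term F 1 + inverse_term F 2 + inverse_term F 3
      + inverse_term F 4 + inverse_term F 5 + inverse_term F 6 + inverse_term F 7 \<and>
    polymap_degree (polymap_inv F) \<le> 15"
proof -
  have F: "mp_deriv j (F $ i) = (if i = j then 1 else 0) - mp_deriv j (H $ i)" for i j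
    by (simp add: assms(2) polymap_id_def derivation_diff[OF derivation_mp_deriv] mp_deriv_var)
  \<comment> \<open>The Jacobian of the identity is symmetric, so symmetry passes from F to
    H.\<close>
  have sym: "mp_deriv j (H $ i) = mp_deriv i (H $ j)" for i j
  proof -
    have "mp_deriv j (F $ i) = mp_deriv i (F $ j)"
      using assms(3) by (simp add: jacobian_def transpose_def vec_eq_iff)
    then show ?thesis using F[of j i] F[of i j] by (cases "i = j") simp_all
  qed
  obtain C :: "'n \<Rightarrow> 'n \<Rightarrow> 'n \<Rightarrow> 'n \<Rightarrow> 'a" where C: "symmetric_form C"
    and H: "\<And>i. H $ i = (\<Sum>j\<in>UNIV. \<Sum>k\<in>UNIV. \<Sum>l\<in>UNIV. mp_const (C i j k l) * (mp_var j * (mp_var k * mp_var l)))"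
    and DH: "\<And>i j. mp_deriv j (H $ i) = 3 * (\<Sum>k\<in>UNIV. \<Sum>l\<in>UNIV. mp_const (C i j k l) * (mp_var k * mp_var l))"
    using cubic_form[OF assms(1) assms(4)[rule_format] sym] by blast
  note tf = torsion_free_rat_algebra[OF assms(1)]
  interpret cubic_inversion C
    by (rule cubic_inversion.intro[OF C tf])
  \<comment> \<open>Packing both constant embeddings into one coefficient homomorphism lets
    \<open>nilpotent_tri\<close> evaluate the Jacobian at the series point \<open>x\<close>.\<close>
  have T: "T = (\<lambda>i j k l. (fps_const \<circ> mp_const) (C i j k l))"
    by (simp add: T_def fun_eq_iff)
  have nil: "nilpotent_cubic_inversion C"
  proof
    show "tri x x (tri x x (tri x x (tri x x v))) = 0" for v
      unfolding T
      by (rule nilpotent_tri[OF C H ring_hom_on_comp[OF ring_hom_on_mp_const ring_hom_on_fps_const] DH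
            torsion_free_fps[OF torsion_free_mpoly[OF tf]] assms(5)])
  qed
  note inv = C H assms(2) nil
  show ?thesis
    unfolding polymap_invertible_def
    using is_polymap_inverse_truncated_inverse[OF inv] polymap_inv_eq[OF inv] polymap_degree_inv[OF inv] by blast
qed

end
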